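(* Let $G$ be a topological group that is not locally compact, let $bG$ be a Hausdorff compactification of $G$, and suppose that $Y = bG \setminus G$ has a BCO (base of countable order). If $Y$ is Ohio complete, then $G$ and $bG$ are separable and metrizable.
   Context: All spaces (including topological groups) are assumed Hausdorff. A Hausdorff compactification $bX$ of a space $X$ is a compact Hausdorff space containing $X$ as a dense subspace. A space $X$ has a base of countable order (BCO) if there is a sequence $\{\mathcal{B}_n\}_{n\in\mathbb{N}}$ of bases for $X$ such that whenever $x \in b_n \in \mathcal{B}_n$ for all $n$ and $(b_n)$ is decreasing (by set inclusion), then $\{b_n : n \in \mathbb{N}\}$ is a base at $x$. A $G_\delta$-subset is an intersection of countably many open subsets. A space $X$ is Ohio complete if in each Hausdorff compactification $bX$ of $X$ there is a $G_\delta$-subset $Z$ of $bX$ such that $X \subset Z$ and each point $y \in Z \setminus X$ is separated from $X$ by a $G_\delta$-subset of $Z$ (that is, there is a $G_\delta$-subset $P$ of $Z$ with $y \in P$ and $P \cap X = \emptyset$). *)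

theory Defs
  imports "HOL-Analysis.Analysis"
begin

section \<open>Bases of countable order\<close>

definition base_of :: "'a topology \<Rightarrow> 'a set set \<Rightarrow> bool" where
  "base_of X \<B> \<longleftrightarrow>
     (\<forall>V\<in>\<B>. openin X V) \<and>
     (\<forall>U x. openin X U \<and> x \<in> U \<longrightarrow> (\<exists>V\<in>\<B>. x \<in> V \<and> V \<subseteq> U))"

definition base_at :: "'a topology \<Rightarrow> 'a \<Rightarrow> 'a set set \<Rightarrow> bool" where
  "base_at X x \<B> \<longleftrightarrow>
     (\<forall>V\<in>\<B>. openin X V \<and> x \<in> V) \<and>
     (\<forall>U. openin X U \<and> x \<in> U \<longrightarrow> (\<exists>V\<in>\<B>. V \<subseteq> U))"

definition has_BCO :: "'a topology \<Rightarrow> bool" where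
  "has_BCO X \<longleftrightarrow>
     (\<exists>\<B> :: nat \<Rightarrow> 'a set set.
        (\<forall>n. base_of X (\<B> n)) \<and>
        (\<forall>x b. (\<forall>n. b n \<in> \<B> n \<and> x \<in> b n) \<and> decseq b \<longrightarrow> base_at X x (range b)))"

section \<open>Hausdorff compactifications\<close>

text \<open>The compactification \<open>K\<close> may live on another type than \<open>X\<close>, so \<open>X\<close> is identified with
  the dense subspace \<open>e ` topspace X\<close> of \<open>K\<close>.\<close>

definition hausdorff_compactification :: "'a topology \<Rightarrow> 'b topology \<Rightarrow> ('a \<Rightarrow> 'b) \<Rightarrow> bool" where
  "hausdorff_compactification X K e \<longleftrightarrow>
     compact_space K \<and> Hausdorff_space K \<and>
     embedding_map X K e \<and> K closure_of (e ` topspace X) = topspace K"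

section \<open>Ohio completeness\<close>

definition ohio_complete_in :: "'b topology \<Rightarrow> 'b set \<Rightarrow> bool" where
  "ohio_complete_in K S \<longleftrightarrow>
     (\<exists>Z. gdelta_in K Z \<and> S \<subseteq> Z \<and>
        (\<forall>y \<in> Z - S. \<exists>P. gdelta_in (subtopology K Z) P \<and> y \<in> P \<and> P \<inter> S = {}))"

text \<open>HOL cannot quantify over the carrier type of \<open>K\<close> inside a definition. The type
  \<^typ>\<open>'a set set\<close> is large enough to carry a copy of every Hausdorff compactification of a space
  on \<^typ>\<open>'a\<close>: send a point \<open>y\<close> to the family of those subsets of the space that have \<open>y\<close>
  in their closure. Consequently the
  defining condition extends to compactifications on arbitrary types; this is
  \<open>ohio_complete_imp_ohio_complete_in\<close> below.\<close>

definition ohio_complete :: "'a topology \<Rightarrow> bool" where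
  "ohio_complete X \<longleftrightarrow>
     (\<forall>(K :: 'a set set topology) e.
        hausdorff_compactification X K e \<longrightarrow> ohio_complete_in K (e ` topspace X))"

lemma ohio_complete_in_homeomorphic_map:
  assumes h: "homeomorphic_map K L h" and S: "S \<subseteq> topspace K"
    and L: "ohio_complete_in L (h ` S)"
  shows "ohio_complete_in K S"
proof -
  obtain Z' where Z': "gdelta_in L Z'" "h ` S \<subseteq> Z'"
    and sep: "\<And>y. y \<in> Z' - h ` S \<Longrightarrow>
        \<exists>P. gdelta_in (subtopology L Z') P \<and> y \<in> P \<and> P \<inter> h ` S = {}"
    using L unfolding ohio_complete_in_def by metis
  have inj: "inj_on h (topspace K)" and im: "h ` topspace K = topspace L"
    using h by (auto simp: homeomorphic_eq_everything_map)
  define Z where "Z = {x \<in> topspace K. h x \<in> Z'}"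
  have Zsub: "Z \<subseteq> topspace K" by (auto simp: Z_def)
  have Z'sub: "Z' \<subseteq> topspace L" using Z'(1) by (rule gdelta_in_subset)
  have hZ: "h ` Z = Z'" using Z'sub im unfolding Z_def by (auto simp: image_iff)
  have gZ: "gdelta_in K Z"
    using homeomorphic_map_gdeltaness[OF h Zsub] hZ Z'(1) by simp
  have hsub: "homeomorphic_map (subtopology K Z) (subtopology L Z') h"
    by (rule homeomorphic_map_subtopologies[OF h]) (use hZ Zsub Z'sub im in auto)
  have "\<exists>P. gdelta_in (subtopology K Z) P \<and> y \<in> P \<and> P \<inter> S = {}" if y: "y \<in> Z - S" for y
  proof -
    have "h y \<in> Z' - h ` S"
      using y hZ inj S Zsub by (auto simp: inj_on_def dest: subsetD)
    from sep[OF this] obtain P' where P': "gdelta_in (subtopology L Z') P'" "h y \<in> P'"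
      "P' \<inter> h ` S = {}" by blast
    define P where "P = {x \<in> Z. h x \<in> P'}"
    have P'sub: "P' \<subseteq> Z'" using gdelta_in_subset[OF P'(1)] by auto
    have hP: "h ` P = P'" using P'sub hZ unfolding P_def by blast
    have Psub: "P \<subseteq> topspace (subtopology K Z)" using Zsub by (auto simp: P_def)
    have "gdelta_in (subtopology K Z) P"
      using homeomorphic_map_gdeltaness[OF hsub Psub] hP P'(1) by simp
    moreover have "y \<in> P" using y P'(2) by (simp add: P_def)
    moreover have "P \<inter> S = {}" using P'(3) by (auto simp: P_def)
    ultimately show ?thesis by blast
  qed
  moreover have "S \<subseteq> Z" using S Z'(2) by (auto simp: Z_def)
  ultimately show ?thesis using gZ unfolding ohio_complete_in_def by blast
qed

lemma compactification_inj_set_set: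
  assumes K: "hausdorff_compactification X K e"
  shows "inj_on (\<lambda>y. {A. A \<subseteq> topspace X \<and> y \<in> K closure_of (e ` A)}) (topspace K)"
proof (rule inj_onI, rule ccontr)
  fix y z assume y: "y \<in> topspace K" and z: "z \<in> topspace K" and "y \<noteq> z"
    and eq: "{A. A \<subseteq> topspace X \<and> y \<in> K closure_of (e ` A)}
           = {A. A \<subseteq> topspace X \<and> z \<in> K closure_of (e ` A)}"
  obtain U V where UV: "openin K U" "openin K V" "y \<in> U" "z \<in> V" "disjnt U V"
    using K y z \<open>y \<noteq> z\<close> unfolding hausdorff_compactification_def Hausdorff_space_def by metis
  define A where "A = {x \<in> topspace X. e x \<in> U}"
  have "y \<in> K closure_of (e ` A)"
    unfolding in_closure_of
  proof (intro conjI allI impI)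
    show "y \<in> topspace K" by fact
    fix T assume T: "y \<in> T \<and> openin K T"
    have "openin K (T \<inter> U)" "y \<in> T \<inter> U" using T UV by auto
    moreover have "y \<in> K closure_of (e ` topspace X)"
      using K y by (simp add: hausdorff_compactification_def)
    ultimately obtain w where "w \<in> e ` topspace X" "w \<in> T \<inter> U"
      unfolding in_closure_of by blast
    then show "\<exists>w. w \<in> e ` A \<and> w \<in> T" by (auto simp: A_def)
  qed
  moreover have "A \<subseteq> topspace X" by (auto simp: A_def)
  ultimately have "z \<in> K closure_of (e ` A)" using eq by blast
  then obtain w where "w \<in> e ` A" "w \<in> V"
    using UV unfolding in_closure_of by blast
  then show False using UV(5) by (auto simp: A_def disjnt_def)
qed

lemma homeomorphic_map_pullback_inverse:
  assumes "inj_on \<phi> (topspace K)"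
  shows "homeomorphic_map K
           (pullback_topology (\<phi> ` topspace K) (inv_into (topspace K) \<phi>) K) \<phi>"
    (is "homeomorphic_map K ?L \<phi>")
proof -
  let ?g = "inv_into (topspace K) \<phi>"
  have inv: "?g (\<phi> x) = x" if "x \<in> topspace K" for x using assms that by simp
  have "continuous_map K ?L \<phi>"
  proof (rule continuous_map_pullback')
    show "continuous_map K K (?g \<circ> \<phi>)"
      by (rule continuous_map_eq[OF continuous_map_id]) (simp add: inv)
    show "topspace K \<subseteq> \<phi> -` (\<phi> ` topspace K)" by auto
  qed
  moreover have "continuous_map ?L K ?g"
    using continuous_map_pullback[OF continuous_map_id] by fastforce
  ultimately have "homeomorphic_maps K ?L \<phi> ?g"
    by (auto simp: homeomorphic_maps_def topspace_pullback_topology inv)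
  then show ?thesis using homeomorphic_map_maps by blast
qed

theorem ohio_complete_imp_ohio_complete_in:
  fixes X :: "'a topology" and K :: "'b topology"
  assumes X: "ohio_complete X" and K: "hausdorff_compactification X K e"
  shows "ohio_complete_in K (e ` topspace X)"
proof -
  define \<phi> where "\<phi> = (\<lambda>y. {A. A \<subseteq> topspace X \<and> y \<in> K closure_of (e ` A)})"
  have "inj_on \<phi> (topspace K)"
    unfolding \<phi>_def by (rule compactification_inj_set_set[OF K])
  then obtain L where h: "homeomorphic_map K L \<phi>"
    using homeomorphic_map_pullback_inverse by blast
  then have hs: "K homeomorphic_space L"
    by (meson homeomorphic_map_imp_homeomorphic_space)
  have e: "embedding_map X K e" and dense: "K closure_of (e ` topspace X) = topspace K"
    using K by (auto simp: hausdorff_compactification_def)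
  have S: "e ` topspace X \<subseteq> topspace K"
    using dense e by (metis continuous_map_image_subset_topspace
        homeomorphic_imp_continuous_map embedding_map_def continuous_map_in_subtopology)
  have "hausdorff_compactification X L (\<phi> \<circ> e)"
    unfolding hausdorff_compactification_def
  proof (intro conjI)
    show "compact_space L" "Hausdorff_space L"
      using K hs homeomorphic_compact_space homeomorphic_Hausdorff_space
      unfolding hausdorff_compactification_def by blast+
    show "embedding_map X L (\<phi> \<circ> e)"
      using e h homeomorphic_imp_surjective_map[OF h]
      by (metis embedding_map_compose embedding_map_def subtopology_topspace)
    show "L closure_of ((\<phi> \<circ> e) ` topspace X) = topspace L"
      using homeomorphic_map_closure_of[OF h S] dense homeomorphic_imp_surjective_map[OF h]
      by (simp add: image_comp)
  qed
  then have "ohio_complete_in L ((\<phi> \<circ> e) ` topspace X)"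
    using X unfolding ohio_complete_def by blast
  then show ?thesis
    using ohio_complete_in_homeomorphic_map[OF h S] by (simp add: image_comp)
qed

end

theory Submission
  imports Defs
begin

text \<open>
  Write \<open>K\<close> for the compactification \<open>bG\<close> and \<open>Y\<close> for the remainder. A topological group that is not
  locally compact is nowhere locally compact, so \<open>Y\<close> is dense in \<open>K\<close> and \<open>K\<close> is a compactification of
  \<open>Y\<close>. Ohio completeness therefore yields a \<open>G\<^sub>\<delta>\<close>-set \<open>Z \<supseteq> Y\<close> of \<open>K\<close> such that every point of \<open>Z\<close>
  outside \<open>Y\<close> lies in a \<open>G\<^sub>\<delta>\<close>-set contained in the group.

  The decisive object is a nonempty compact subset of \<open>G\<close> with a countable neighbourhood base. If
  \<open>Z \<noteq> Y\<close>, it is found inside one of these separating \<open>G\<^sub>\<delta>\<close>-sets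
  (\<open>gdelta_point_countable_character\<close>). If \<open>Z = Y\<close>, then \<open>G\<close> is \<open>\<sigma>\<close>-compact and hence satisfies the
  countable chain condition (\<open>sigma_compact_group_ccc\<close>), which passes to \<open>K\<close> and to \<open>Y\<close>. As a dense
  \<open>G\<^sub>\<delta>\<close>-subset of a compact space, \<open>Y\<close> is a Baire space, and a Baire space with the chain condition and
  a base of countable order has a countable \<open>\<pi>\<close>-base (\<open>countable_pi_base_BCO\<close>). The \<open>\<pi>\<close>-base
  passes from \<open>Y\<close> to \<open>K\<close> and to \<open>G\<close>; a topological group with a countable \<open>\<pi>\<close>-base is first countable,
  so a single point will do.

  Translates of such a compact set show that \<open>G\<close> is of countable type (\<open>group_countable_type\<close>), and
  then \<open>Y\<close> is Lindelof by the theorem of Henriksen and Isbell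
  (\<open>countable_type_imp_Lindelof_remainder\<close>). A regular Lindelof space with a base of countable order is
  second countable (\<open>Lindelof_space_BCO_imp_second_countable\<close>). Passing once more through
  \<open>\<pi>\<close>-bases, \<open>G\<close> is second countable. Now \<open>K\<close> is the union of two subspaces with countable bases, so
  it has a countable network, and a compact Hausdorff space with a countable network is
  metrizable (\<open>compact_countable_network_imp_metrizable\<close>).
\<close>

section \<open>Dense embeddings and closures\<close>

lemma regular_space_closure_nbhd:
  assumes "regular_space X" "openin X U" "x \<in> U"
  obtains V where "openin X V" "x \<in> V" "X closure_of V \<subseteq> U"
proof -
  have "neighbourhood_base_of (closedin X) X"
    using assms(1) by (simp add: neighbourhood_base_of_closedin)
  then obtain V C where "openin X V" "closedin X C" "x \<in> V" "V \<subseteq> C" "C \<subseteq> U"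
    using assms(2,3) unfolding neighbourhood_base_of by metis
  then show thesis using that[of V] closure_of_minimal[of V C X] by auto
qed

lemma closure_ofE:
  assumes "p \<in> X closure_of S" "openin X T" "p \<in> T"
  obtains y where "y \<in> S" "y \<in> T"
  using assms by (auto simp: in_closure_of)

lemma embedding_map_continuous_map: "embedding_map X K e \<Longrightarrow> continuous_map X K e"
  by (metis embedding_map_def homeomorphic_imp_continuous_map continuous_map_in_subtopology)

lemma embedding_map_open_image:
  assumes "embedding_map X K e" "openin X U"
  obtains T where "openin K T" "U = {x \<in> topspace X. e x \<in> T}"
proof -
  have h: "homeomorphic_map X (subtopology K (e ` topspace X)) e"
    using assms(1) by (simp add: embedding_map_def)
  have U: "U \<subseteq> topspace X" using assms(2) by (rule openin_subset)
  have inj: "inj_on e (topspace X)" using h by (simp add: homeomorphic_eq_everything_map)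
  have "openin (subtopology K (e ` topspace X)) (e ` U)"
    using homeomorphic_map_openness[OF h U] assms(2) by simp
  then obtain T where T: "openin K T" "e ` U = T \<inter> e ` topspace X"
    by (auto simp: openin_subtopology)
  have "U = {x \<in> topspace X. e x \<in> T}"
  proof
    show "U \<subseteq> {x \<in> topspace X. e x \<in> T}" using T(2) U by blast
    show "{x \<in> topspace X. e x \<in> T} \<subseteq> U"
    proof
      fix x assume x: "x \<in> {x \<in> topspace X. e x \<in> T}"
      then have "e x \<in> e ` U" using T(2) by blast
      then obtain u where "u \<in> U" "e x = e u" by blast
      then show "x \<in> U" using inj x U by (auto dest: inj_onD)
    qed
  qed
  with T(1) show thesis by (rule that)
qed

lemma embedding_map_preimage_compactin:
  assumes "embedding_map X K e" "compactin K C" "C \<subseteq> e ` topspace X"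
  shows "compactin X {x \<in> topspace X. e x \<in> C}"
proof -
  have h: "homeomorphic_map X (subtopology K (e ` topspace X)) e"
    using assms(1) by (simp add: embedding_map_def)
  have "e ` {x \<in> topspace X. e x \<in> C} = C" using assms(3) by blast
  moreover have "compactin (subtopology K (e ` topspace X)) C"
    using assms(2,3) by (simp add: compactin_subtopology)
  ultimately show ?thesis
    using homeomorphic_map_compactness[OF h, of "{x \<in> topspace X. e x \<in> C}"] by auto
qed

section \<open>Bases of countable order in Lindelof spaces\<close>

lemma base_ofE:
  assumes "base_of X \<B>" "openin X U" "x \<in> U"
  obtains V where "V \<in> \<B>" "openin X V" "x \<in> V" "V \<subseteq> U"
proof -
  have "\<exists>V\<in>\<B>. x \<in> V \<and> V \<subseteq> U" "\<forall>V\<in>\<B>. openin X V"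
    using assms by (simp_all add: base_of_def)
  then show thesis using that by auto
qed

text \<open>A base of countable order only speaks about decreasing sequences of base sets, so it has to be
  combined with a device that produces such sequences from countably many sets. The device is a
  countable tree of nodes \<open>(b, F)\<close> with \<open>F \<subseteq> b\<close>, where \<open>b\<close> is open and \<open>F\<close> is the part of \<open>b\<close> that the
  children have to take care of: the children of a node of level \<open>n\<close> have their first components in
  the \<open>n\<close>-th base and inside \<open>b\<close>, and their second components cover \<open>F\<close> in the sense of \<open>R\<close>.
  If a point is never lost, that is, whenever it lies in the second component of a node it also
  lies in the second component of some child, then it determines an infinite branch; the first
  components along the branch decrease and hence form a base at the point. The set \<open>\<H>\<close> records
  the pairs (second component, union over the children), so that points that are never lost can be
  recognised from countably many conditions. With \<open>R\<close> being inclusion no point is lost; with \<open>R\<close>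
  being inclusion in the closure, and open second components, only a meagre set is.\<close>

lemma BCO_countable_tree:
  fixes X :: "'a topology" and Q :: "'a set \<Rightarrow> 'a set \<Rightarrow> bool" and R :: "'a set \<Rightarrow> 'a set \<Rightarrow> bool"
  assumes BCO: "has_BCO X"
    and sub: "\<And>b F. Q b F \<Longrightarrow> F \<subseteq> b"
    and root: "Q b0 F0"
    and step: "\<And>\<B> b F. base_of X \<B> \<Longrightarrow> Q b F \<Longrightarrow>
      \<exists>\<C>. countable \<C> \<and> (\<forall>(b',F') \<in> \<C>. Q b' F' \<and> b' \<in> \<B> \<and> b' \<subseteq> b) \<and> R F (\<Union>(snd ` \<C>))"
  obtains \<N> \<H> where "countable \<N>" "\<And>b F. (b,F) \<in> \<N> \<Longrightarrow> Q b F"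
    "countable \<H>" "\<And>F S. (F,S) \<in> \<H> \<Longrightarrow> R F S \<and> (\<exists>b. (b,F) \<in> \<N>) \<and> (\<exists>\<C>. \<C> \<subseteq> \<N> \<and> S = \<Union>(snd ` \<C>))"
    "\<And>x U. x \<in> F0 \<Longrightarrow> \<forall>(F,S)\<in>\<H>. x \<in> F \<longrightarrow> x \<in> S \<Longrightarrow> openin X U \<Longrightarrow> x \<in> U \<Longrightarrow>
       \<exists>(b,F)\<in>\<N>. x \<in> b \<and> b \<subseteq> U"
proof -
  obtain \<B> where base: "\<And>n. base_of X (\<B> n)"
    and bco: "\<And>x b. (\<forall>n. b n \<in> \<B> n \<and> x \<in> b n) \<Longrightarrow> decseq b \<Longrightarrow> base_at X x (range b)"
    using BCO unfolding has_BCO_def by blast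
  define good where "good n \<nu> \<C> \<longleftrightarrow> countable \<C> \<and>
      (\<forall>(b',F') \<in> \<C>. Q b' F' \<and> b' \<in> \<B> n \<and> b' \<subseteq> fst \<nu>) \<and> R (snd \<nu>) (\<Union>(snd ` \<C>))"
    for n \<nu> \<C>
  define ch where "ch n \<nu> = (SOME \<C>. good n \<nu> \<C>)" for n \<nu>
  have ch: "good n \<nu> (ch n \<nu>)" if "Q (fst \<nu>) (snd \<nu>)" for n \<nu>
    unfolding ch_def by (rule someI_ex) (use step[OF base that] in \<open>simp add: good_def\<close>)
  define L where "L = rec_nat {(b0,F0)} (\<lambda>n S. \<Union>\<nu>\<in>S. ch n \<nu>)"
  have L0: "L 0 = {(b0,F0)}" and LS: "\<And>n. L (Suc n) = (\<Union>\<nu>\<in>L n. ch n \<nu>)"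
    by (simp_all add: L_def)
  have QL: "Q (fst \<nu>) (snd \<nu>)" if "\<nu> \<in> L n" for n \<nu>
    using that
  proof (induction n arbitrary: \<nu>)
    case 0 then show ?case using root by (simp add: L0)
  next
    case (Suc n)
    then obtain \<mu> where "\<mu> \<in> L n" "\<nu> \<in> ch n \<mu>" by (auto simp: LS)
    then show ?case using ch[OF Suc.IH, of \<mu> n] unfolding good_def by fastforce
  qed
  have cL: "countable (L n)" for n
  proof (induction n)
    case (Suc n)
    then show ?case unfolding LS using ch QL by (intro countable_UN) (auto simp: good_def)
  qed (simp add: L0)
  define \<N> where "\<N> = (\<Union>n. L n)"
  define \<H> where "\<H> = (\<Union>n. (\<lambda>\<nu>. (snd \<nu>, \<Union>(snd ` ch n \<nu>))) ` L n)"
  show thesis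
  proof
    show "countable \<N>" "countable \<H>" by (auto simp: \<N>_def \<H>_def cL)
    show "Q b F" if "(b,F) \<in> \<N>" for b F using that QL by (fastforce simp: \<N>_def)
    show "R F S \<and> (\<exists>b. (b,F) \<in> \<N>) \<and> (\<exists>\<C>. \<C> \<subseteq> \<N> \<and> S = \<Union>(snd ` \<C>))"
      if FS: "(F,S) \<in> \<H>" for F S
    proof -
      obtain n \<nu> where \<nu>: "\<nu> \<in> L n" "F = snd \<nu>" "S = \<Union>(snd ` ch n \<nu>)"
        using FS by (auto simp: \<H>_def)
      have "ch n \<nu> \<subseteq> L (Suc n)" unfolding LS using \<nu>(1) by blast
      then have "ch n \<nu> \<subseteq> \<N>" by (auto simp: \<N>_def)
      moreover have "(fst \<nu>, F) \<in> \<N>" using \<nu> by (auto simp: \<N>_def)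
      moreover have "R F S" using ch[OF QL[OF \<nu>(1)], of n] \<nu> by (simp add: good_def)
      ultimately show ?thesis using \<nu>(3) by blast
    qed
    fix x U
    assume x0: "x \<in> F0" and H: "\<forall>(F,S)\<in>\<H>. x \<in> F \<longrightarrow> x \<in> S" and U: "openin X U" "x \<in> U"
    have "\<exists>\<nu>. \<forall>n. (\<nu> n \<in> L n \<and> x \<in> snd (\<nu> n)) \<and> \<nu> (Suc n) \<in> ch n (\<nu> n)"
    proof (rule dependent_nat_choice)
      show "\<exists>\<nu>. \<nu> \<in> L 0 \<and> x \<in> snd \<nu>" using x0 by (simp add: L0)
      fix \<nu> n assume \<nu>: "\<nu> \<in> L n \<and> x \<in> snd \<nu>"
      then have "(snd \<nu>, \<Union>(snd ` ch n \<nu>)) \<in> \<H>" by (auto simp: \<H>_def)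
      then have "x \<in> \<Union>(snd ` ch n \<nu>)" using H \<nu> by blast
      then show "\<exists>\<mu>. (\<mu> \<in> L (Suc n) \<and> x \<in> snd \<mu>) \<and> \<mu> \<in> ch n \<nu>"
        using \<nu> unfolding LS by blast
    qed
    then obtain \<nu> where \<nu>: "\<And>n. \<nu> n \<in> L n" "\<And>n. x \<in> snd (\<nu> n)" "\<And>n. \<nu> (Suc n) \<in> ch n (\<nu> n)"
      by blast
    \<comment> \<open>The root need not belong to any base, hence the shift by one.\<close>
  define b where "b n = fst (\<nu> (Suc n))" for n
    have chn: "fst (\<nu> (Suc n)) \<in> \<B> n \<and> fst (\<nu> (Suc n)) \<subseteq> fst (\<nu> n)" for n
      using ch[OF QL[OF \<nu>(1)], of n n] \<nu>(3)[of n] by (fastforce simp: good_def case_prod_unfold)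
    have "base_at X x (range b)"
    proof (rule bco)
      show "\<forall>n. b n \<in> \<B> n \<and> x \<in> b n"
        using chn sub[OF QL[OF \<nu>(1)]] \<nu>(2) unfolding b_def by blast
      show "decseq b"
        by (rule decseq_SucI) (use chn in \<open>auto simp: b_def\<close>)
    qed
    then have "\<exists>V\<in>range b. V \<subseteq> U" "\<forall>V\<in>range b. x \<in> V"
      using U by (simp_all add: base_at_def)
    then obtain n where "b n \<subseteq> U" "x \<in> b n" by auto
    moreover have "\<nu> (Suc n) \<in> \<N>" using \<nu>(1) by (auto simp: \<N>_def)
    ultimately show "\<exists>(b,F)\<in>\<N>. x \<in> b \<and> b \<subseteq> U"
      unfolding b_def by (intro bexI[of _ "\<nu> (Suc n)"]) (auto simp: case_prod_unfold)
  qed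
qed

text \<open>Countably many children may fail to cover an open set, which need not be Lindelof. The
  tree therefore carries along a closed set \<open>F\<close> inside each open set \<open>b\<close>: closed subsets of a Lindelof
  space are Lindelof, and regularity lets closures of smaller open sets serve as the closed
  parts of the children. All points survive, so the open sets of the tree form a countable base.\<close>

lemma Lindelof_space_BCO_imp_second_countable:
  assumes "Lindelof_space X" "regular_space X" "has_BCO X"
  shows "second_countable X"
proof -
  let ?Q = "\<lambda>b F. openin X b \<and> closedin X F \<and> F \<subseteq> b"
  have step: "\<exists>\<C>. countable \<C> \<and> (\<forall>(b',F') \<in> \<C>. ?Q b' F' \<and> b' \<in> \<B> \<and> b' \<subseteq> b) \<and> F \<subseteq> \<Union>(snd ` \<C>)"
    if \<B>: "base_of X \<B>" and Q: "?Q b F" for \<B> b F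
  proof -
    have "\<exists>v V. v \<in> \<B> \<and> v \<subseteq> b \<and> openin X V \<and> x \<in> V \<and> X closure_of V \<subseteq> v" if "x \<in> F" for x
    proof -
      have "x \<in> b" using that Q by blast
      then obtain v where v: "v \<in> \<B>" "openin X v" "x \<in> v" "v \<subseteq> b"
        using base_ofE[OF \<B>] Q by metis
      then show ?thesis using regular_space_closure_nbhd[OF assms(2) v(2,3)] v by metis
    qed
    then obtain v V where vV: "\<And>x. x \<in> F \<Longrightarrow> v x \<in> \<B> \<and> v x \<subseteq> b \<and> openin X (V x) \<and> x \<in> V x \<and> X closure_of (V x) \<subseteq> v x"
      by metis
    have "Lindelof_space (subtopology X F)"
      using assms(1) Q Lindelof_space_closedin_subtopology by blast
    moreover have "F \<subseteq> topspace X" using Q closedin_subset by blast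
    moreover have "\<forall>W\<in>V ` F. openin X W" "F \<subseteq> \<Union>(V ` F)" using vV by auto
    ultimately obtain \<V> where \<V>: "countable \<V>" "\<V> \<subseteq> V ` F" "F \<subseteq> \<Union>\<V>"
      by (meson Lindelof_space_subtopology_subset)
    then obtain J where J: "countable J" "J \<subseteq> F" "F \<subseteq> \<Union>(V ` J)"
      by (metis countable_subset_image)
    let ?C = "(\<lambda>x. (v x, X closure_of (V x) \<inter> F)) ` J"
    have "?Q b' F' \<and> b' \<in> \<B> \<and> b' \<subseteq> b" if "(b',F') \<in> ?C" for b' F'
    proof -
      from that obtain x where "x \<in> F" "b' = v x" "F' = X closure_of (V x) \<inter> F"
        using J by auto
      then show ?thesis using vV[of x] Q \<B> by (auto simp: base_of_def)
    qed
    moreover have "F \<subseteq> \<Union>(snd ` ?C)"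
    proof
      fix y assume y: "y \<in> F"
      then obtain x where "x \<in> J" "y \<in> V x" using J by blast
      moreover from this have "V x \<subseteq> X closure_of (V x)"
        using vV J by (meson closure_of_subset openin_subset subsetD)
      ultimately show "y \<in> \<Union>(snd ` ?C)" using y by force
    qed
    ultimately show "\<exists>\<C>. countable \<C> \<and> (\<forall>(b',F') \<in> \<C>. ?Q b' F' \<and> b' \<in> \<B> \<and> b' \<subseteq> b) \<and> F \<subseteq> \<Union>(snd ` \<C>)"
      using J(1) by (intro exI[of _ ?C]) blast
  qed
  obtain \<N> \<H> where N: "countable \<N>" "\<And>b F. (b,F) \<in> \<N> \<Longrightarrow> ?Q b F"
    and H: "countable \<H>" "\<And>F S. (F,S) \<in> \<H> \<Longrightarrow> F \<subseteq> S \<and> (\<exists>b. (b,F) \<in> \<N>) \<and> (\<exists>\<C>. \<C> \<subseteq> \<N> \<and> S = \<Union>(snd ` \<C>))"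
    and fine: "\<And>x U. x \<in> topspace X \<Longrightarrow> \<forall>(F,S)\<in>\<H>. x \<in> F \<longrightarrow> x \<in> S \<Longrightarrow> openin X U \<Longrightarrow> x \<in> U \<Longrightarrow>
       \<exists>(b,F)\<in>\<N>. x \<in> b \<and> b \<subseteq> U"
    by (rule BCO_countable_tree[OF assms(3) _ _ step, of "topspace X" "topspace X"]) blast+
  show ?thesis
    unfolding second_countable_def
  proof (intro exI[of _ "fst ` \<N>"] conjI allI impI ballI)
    fix U x assume U: "openin X U \<and> x \<in> U"
    then have "x \<in> topspace X" using openin_subset by blast
    moreover have "\<forall>(F,S)\<in>\<H>. x \<in> F \<longrightarrow> x \<in> S" using H(2) by blast
    ultimately have "\<exists>(b,F)\<in>\<N>. x \<in> b \<and> b \<subseteq> U" using fine[of x U] U by blast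
    then show "\<exists>V\<in>fst ` \<N>. x \<in> V \<and> V \<subseteq> U" by force
  qed (use N in auto)
qed

section \<open>Countable \<open>\<pi>\<close>-bases\<close>

definition pi_base :: "'a topology \<Rightarrow> 'a set set \<Rightarrow> bool" where
  "pi_base X \<P> \<longleftrightarrow> (\<forall>P\<in>\<P>. openin X P \<and> P \<noteq> {}) \<and> (\<forall>U. openin X U \<and> U \<noteq> {} \<longrightarrow> (\<exists>P\<in>\<P>. P \<subseteq> U))"

lemma pi_baseE:
  assumes "pi_base X \<P>" "openin X U" "U \<noteq> {}"
  obtains P where "P \<in> \<P>" "openin X P" "P \<noteq> {}" "P \<subseteq> U"
proof -
  have "\<exists>P\<in>\<P>. P \<subseteq> U" "\<forall>P\<in>\<P>. openin X P \<and> P \<noteq> {}"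
    using assms by (simp_all add: pi_base_def)
  then show thesis using that by auto
qed

lemma second_countable_imp_countable_pi_base:
  assumes "second_countable X"
  obtains \<P> where "countable \<P>" "pi_base X \<P>"
proof -
  obtain \<B> where B: "countable \<B>" "\<forall>V\<in>\<B>. openin X V"
    "\<forall>U x. openin X U \<and> x \<in> U \<longrightarrow> (\<exists>V\<in>\<B>. x \<in> V \<and> V \<subseteq> U)"
    using assms unfolding second_countable_def by (elim exE conjE)
  have "pi_base X (\<B> - {{}})"
    unfolding pi_base_def
  proof (intro conjI allI impI)
    fix U assume U: "openin X U \<and> U \<noteq> {}"
    then obtain x where "x \<in> U" by blast
    then obtain V where "V \<in> \<B>" "x \<in> V" "V \<subseteq> U" using B(3)[rule_format, of U x] U by blast
    then show "\<exists>P\<in>\<B> - {{}}. P \<subseteq> U" by blast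
  qed (use B(2) in simp)
  moreover have "countable (\<B> - {{}})" using B(1) by simp
  ultimately show thesis using that by blast
qed

text \<open>An open set \<open>W\<close> is contained in the closure of its trace on a dense subspace. In a regular space
  this makes it small as soon as its trace is small.\<close>

lemma pi_base_dense_subspace_extend:
  assumes K: "regular_space K" and Y: "K closure_of Y = topspace K"
    and P: "countable \<P>" "pi_base (subtopology K Y) \<P>"
  obtains \<Q> where "countable \<Q>" "pi_base K \<Q>"
proof -
  have "\<forall>P\<in>\<P>. \<exists>W. openin K W \<and> P = W \<inter> Y"
    using P(2) by (simp add: pi_base_def openin_subtopology)
  then obtain w where w: "\<And>P. P \<in> \<P> \<Longrightarrow> openin K (w P) \<and> P = w P \<inter> Y" by metis
  have ne: "P \<noteq> {}" if "P \<in> \<P>" for P using P(2) that by (simp add: pi_base_def)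
  have "pi_base K (w ` \<P>)"
    unfolding pi_base_def
  proof (intro conjI allI impI ballI)
    show "openin K Q" "Q \<noteq> {}" if "Q \<in> w ` \<P>" for Q using that w ne by fastforce+
    fix U assume U: "openin K U \<and> U \<noteq> {}"
    then obtain x where x: "x \<in> U" by blast
    obtain V where V: "openin K V" "x \<in> V" "K closure_of V \<subseteq> U"
      using regular_space_closure_nbhd[OF K _ x] U by metis
    have "x \<in> K closure_of Y" unfolding Y using x U openin_subset by blast
    then have "V \<inter> Y \<noteq> {}" using closure_ofE[OF _ V(1,2)] by blast
    moreover have "openin (subtopology K Y) (V \<inter> Y)" using V(1) by (auto simp: openin_subtopology)
    ultimately obtain P where P: "P \<in> \<P>" "P \<subseteq> V \<inter> Y" using pi_baseE[OF P(2)] by metis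
    have "w P \<subseteq> K closure_of (w P \<inter> Y)"
      using openin_Int_closure_of_subset[of K "w P" Y] w[OF P(1)] Y openin_subset[of K "w P"] by blast
    also have "\<dots> \<subseteq> K closure_of V" using w[OF P(1)] P(2) by (intro closure_of_mono) blast
    finally show "\<exists>Q\<in>w ` \<P>. Q \<subseteq> U" using V(3) P(1) by blast
  qed
  moreover have "countable (w ` \<P>)" using P(1) by simp
  ultimately show thesis using that by blast
qed

lemma pi_base_dense_embedding_pullback:
  assumes e: "embedding_map X K e" and d: "K closure_of (e ` topspace X) = topspace K"
    and P: "countable \<P>" "pi_base K \<P>"
  obtains \<Q> where "countable \<Q>" "pi_base X \<Q>"
proof -
  have cont: "continuous_map X K e"
    by (rule embedding_map_continuous_map[OF e])
  let ?pre = "\<lambda>P. {x \<in> topspace X. e x \<in> P}"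
  have meet: "?pre P \<noteq> {}" if "openin K P" "P \<noteq> {}" for P
  proof -
    obtain p where p: "p \<in> P" using \<open>P \<noteq> {}\<close> by blast
    then have "p \<in> K closure_of (e ` topspace X)" unfolding d using that openin_subset by blast
    then show ?thesis using closure_ofE[OF _ \<open>openin K P\<close> p] by blast
  qed
  have "pi_base X (?pre ` \<P>)"
    unfolding pi_base_def
  proof (intro conjI allI impI ballI)
    fix Q assume "Q \<in> ?pre ` \<P>"
    then obtain P' where "P' \<in> \<P>" "Q = ?pre P'" by blast
    then show "openin X Q" "Q \<noteq> {}"
      using P(2) meet[of P'] openin_continuous_map_preimage[OF cont] by (simp_all add: pi_base_def)
  next
    fix U assume U: "openin X U \<and> U \<noteq> {}"
    then obtain T where T: "openin K T" "U = ?pre T" using embedding_map_open_image[OF e] by metis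
    then have "T \<noteq> {}" using U by blast
    then obtain P' where "P' \<in> \<P>" "P' \<subseteq> T" using pi_baseE[OF P(2) T(1)] by metis
    moreover from this have "?pre P' \<subseteq> U" unfolding T(2) by auto
    ultimately show "\<exists>Q\<in>?pre ` \<P>. Q \<subseteq> U" by (intro bexI[of _ "?pre P'"]) auto
  qed
  moreover have "countable (?pre ` \<P>)" using P(1) by simp
  ultimately show thesis using that by blast
qed

section \<open>The countable chain condition and Baire spaces\<close>

text \<open>The countable chain condition. The usual formulation, that disjoint families of nonempty open sets
  are countable, is equivalent, by passing to a maximal disjoint family of open sets each contained in a
  member of \<open>\<U>\<close>. The present form provides the countable families from which a \<open>\<pi>\<close>-base is built.\<close>

definition ccc_space :: "'a topology \<Rightarrow> bool" where
  "ccc_space X \<longleftrightarrow> (\<forall>\<U>. (\<forall>U\<in>\<U>. openin X U) \<longrightarrow>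
     (\<exists>\<V>. countable \<V> \<and> \<V> \<subseteq> \<U> \<and> \<Union>\<U> \<subseteq> X closure_of \<Union>\<V>))"

lemma ccc_spaceE:
  assumes X: "ccc_space X" and f: "\<And>i. i \<in> I \<Longrightarrow> openin X (f i)"
  obtains J where "countable J" "J \<subseteq> I" "\<Union>(f ` I) \<subseteq> X closure_of \<Union>(f ` J)"
proof -
  have "\<forall>U\<in>f ` I. openin X U" using f by blast
  then have "\<exists>\<V>. countable \<V> \<and> \<V> \<subseteq> f ` I \<and> \<Union>(f ` I) \<subseteq> X closure_of \<Union>\<V>"
    using X[unfolded ccc_space_def, rule_format, of "f ` I"] by blast
  then obtain \<V> where V: "countable \<V>" "\<V> \<subseteq> f ` I" "\<Union>(f ` I) \<subseteq> X closure_of \<Union>\<V>"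
    by blast
  obtain J where "countable J" "J \<subseteq> I" "\<V> = f ` J"
    using V(1,2) by (metis countable_subset_image)
  then show thesis using that V(3) by blast
qed

lemma ccc_space_dense_image:
  assumes X: "ccc_space X" and e: "continuous_map X K e" and d: "K closure_of (e ` topspace X) = topspace K"
  shows "ccc_space K"
  unfolding ccc_space_def
proof (intro allI impI)
  fix \<U> assume \<U>: "\<forall>U\<in>\<U>. openin K U"
  let ?pre = "\<lambda>U. {x \<in> topspace X. e x \<in> U}"
  have pre: "openin X (?pre U)" if "openin K U" for U
    using e that by (simp add: openin_continuous_map_preimage)
  obtain \<V> where V: "countable \<V>" "\<V> \<subseteq> \<U>" "\<Union>(?pre ` \<U>) \<subseteq> X closure_of \<Union>(?pre ` \<V>)"
    by (rule ccc_spaceE[OF X, of \<U> ?pre]) (use pre \<U> in auto)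
  have "\<Union>\<U> \<subseteq> K closure_of \<Union>\<V>"
  proof
    fix p assume "p \<in> \<Union>\<U>"
    then obtain U where U: "U \<in> \<U>" "p \<in> U" by blast
    then have pK: "p \<in> topspace K" using \<U> openin_subset by blast
    show "p \<in> K closure_of \<Union>\<V>"
      unfolding in_closure_of
    proof (intro conjI allI impI pK)
      fix T assume T: "p \<in> T \<and> openin K T"
      then have "openin K (T \<inter> U)" "p \<in> T \<inter> U" using U \<U> by auto
      then obtain x where x: "x \<in> topspace X" "e x \<in> T" "e x \<in> U"
        using closure_ofE[of p K "e ` topspace X" "T \<inter> U"] pK d by auto
      then have "x \<in> X closure_of \<Union>(?pre ` \<V>)" using V(3) U by blast
      moreover have "x \<in> ?pre T" "openin X (?pre T)" using x T pre by auto
      ultimately obtain z where "z \<in> \<Union>(?pre ` \<V>)" "z \<in> ?pre T"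
        using closure_ofE[of x X "\<Union>(?pre ` \<V>)" "?pre T"] by blast
      then show "\<exists>y. y \<in> \<Union>\<V> \<and> y \<in> T" by blast
    qed
  qed
  with V show "\<exists>\<V>. countable \<V> \<and> \<V> \<subseteq> \<U> \<and> \<Union>\<U> \<subseteq> K closure_of \<Union>\<V>" by blast
qed

lemma ccc_space_dense_subspace:
  assumes K: "ccc_space K" and Y: "K closure_of Y = topspace K" "Y \<subseteq> topspace K"
  shows "ccc_space (subtopology K Y)"
  unfolding ccc_space_def
proof (intro allI impI)
  fix \<U> assume \<U>: "\<forall>U\<in>\<U>. openin (subtopology K Y) U"
  have "\<forall>U\<in>\<U>. \<exists>W. openin K W \<and> U = W \<inter> Y" using \<U> by (simp add: openin_subtopology)
  then obtain w where w: "\<And>U. U \<in> \<U> \<Longrightarrow> openin K (w U) \<and> U = w U \<inter> Y" by metis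
  obtain \<V> where V: "countable \<V>" "\<V> \<subseteq> \<U>" "\<Union>(w ` \<U>) \<subseteq> K closure_of \<Union>(w ` \<V>)"
    by (rule ccc_spaceE[OF K, of \<U> w]) (use w in auto)
  have "\<Union>\<U> \<subseteq> subtopology K Y closure_of \<Union>\<V>"
  proof
    fix p assume "p \<in> \<Union>\<U>"
    then obtain U where U: "U \<in> \<U>" "p \<in> U" by blast
    then have p: "p \<in> w U" "p \<in> Y" "p \<in> K closure_of \<Union>(w ` \<V>)" using w V(3) by blast+
    show "p \<in> subtopology K Y closure_of \<Union>\<V>"
      unfolding in_closure_of
    proof (intro conjI allI impI)
      show "p \<in> topspace (subtopology K Y)" using p Y(2) by auto
      fix T assume "p \<in> T \<and> openin (subtopology K Y) T"
      then obtain T' where T': "openin K T'" "T = T' \<inter> Y" "p \<in> T'" by (auto simp: openin_subtopology)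
      then obtain q V where q: "q \<in> T'" "V \<in> \<V>" "q \<in> w V"
        using closure_ofE[OF p(3)] by blast
      have "openin K (T' \<inter> w V)" using T'(1) q(2) V(2) w by blast
      moreover have "q \<in> K closure_of Y" using T'(1) q(1) Y(1) openin_subset by blast
      ultimately obtain y where "y \<in> T' \<inter> w V" "y \<in> Y"
        using q closure_ofE[of q K Y "T' \<inter> w V"] by blast
      then show "\<exists>y. y \<in> \<Union>\<V> \<and> y \<in> T" using T' q V w by blast
    qed
  qed
  with V show "\<exists>\<V>. countable \<V> \<and> \<V> \<subseteq> \<U> \<and> \<Union>\<U> \<subseteq> subtopology K Y closure_of \<Union>\<V>" by blast
qed

text \<open>Baire's theorem in the compact space applies to the countably many open sets whose intersection is
  \<open>Y\<close> together with extensions of the members of \<open>\<D>\<close> to open sets of \<open>K\<close>.\<close>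

lemma dense_gdelta_Baire:
  assumes K: "compact_space K" "Hausdorff_space K"
    and Y: "gdelta_in K Y" "K closure_of Y = topspace K"
    and D: "countable \<D>" "\<And>D. D \<in> \<D> \<Longrightarrow> openin (subtopology K Y) D \<and> subtopology K Y closure_of D = Y"
    and U: "openin (subtopology K Y) U" "U \<noteq> {}"
  obtains x where "x \<in> U" "\<And>D. D \<in> \<D> \<Longrightarrow> x \<in> D"
proof -
  obtain O' where O': "\<And>n::nat. openin K (O' n)" "\<Inter>(range O') = Y"
    using Y(1) unfolding gdelta_in_descending by blast
  have "\<forall>D\<in>\<D>. \<exists>W. openin K W \<and> D = W \<inter> Y" using D by (simp add: openin_subtopology)
  then obtain w where w: "\<And>D. D \<in> \<D> \<Longrightarrow> openin K (w D) \<and> D = w D \<inter> Y" by metis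
  let ?G = "range O' \<union> w ` \<D>"
  have cl: "K closure_of (\<Inter>?G) = topspace K"
  proof (rule Baire_category)
    show "completely_metrizable_space K \<or> locally_compact_space K \<and> regular_space K"
      using K compact_Hausdorff_or_regular_imp_normal_space compact_imp_locally_compact_space
        compact_Hausdorff_imp_regular_space by blast
    show "countable ?G" using D(1) by simp
    fix T assume T: "T \<in> ?G"
    have "Y \<subseteq> K closure_of T"
    proof (cases "T \<in> range O'")
      case True
      then have "Y \<subseteq> T" "T \<subseteq> topspace K" using O' openin_subset by blast+
      then show ?thesis using closure_of_subset by blast
    next
      case False
      then obtain D where DD: "D \<in> \<D>" "T = w D" using T by blast
      have "Y = subtopology K Y closure_of D" using D(2) DD by simp
      also have "\<dots> \<subseteq> K closure_of D" by (simp add: closure_of_subtopology_subset)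
      also have "\<dots> \<subseteq> K closure_of T" using w DD by (metis closure_of_mono inf_le1)
      finally show ?thesis .
    qed
    then have "K closure_of Y \<subseteq> K closure_of T" by (simp add: closure_of_minimal)
    moreover have "openin K T" using T O'(1) w by auto
    ultimately show "openin K T \<and> K closure_of T = topspace K"
      using Y(2) closure_of_subset_topspace[of K T] by auto
  qed
  obtain U' where U': "openin K U'" "U = U' \<inter> Y" using U(1) by (auto simp: openin_subtopology)
  then obtain u where u: "u \<in> U'" using U(2) by blast
  then have "u \<in> K closure_of (\<Inter>?G)" unfolding cl using U'(1) openin_subset by blast
  then obtain x where x: "x \<in> \<Inter>?G" "x \<in> U'"
    using U'(1) u by (rule closure_ofE)
  have "x \<in> \<Inter>(range O')" using x(1) by simp
  then have "x \<in> Y" unfolding O'(2) .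
  moreover have "x \<in> w D" if "D \<in> \<D>" for D using x(1) that by simp
  ultimately show thesis using that[of x] x(2) U'(2) w by blast
qed

text \<open>By the chain condition, countably many sets from the next base already have a union that is dense
  in a given open set, so a countable tree exists in which the children of a node are dense in it. A
  point is lost at a node only if it lies in a nowhere dense set; as there are countably many nodes and
  \<open>Y\<close> is a Baire space, the points that are never lost are dense, and the nodes form a base at each of
  them. Hence the nonempty nodes are a \<open>\<pi>\<close>-base.\<close>

lemma countable_pi_base_BCO:
  assumes K: "compact_space K" "Hausdorff_space K"
    and Y: "gdelta_in K Y" "K closure_of Y = topspace K"
    and ccc: "ccc_space (subtopology K Y)" and BCO: "has_BCO (subtopology K Y)"
  obtains \<P> where "countable \<P>" "pi_base (subtopology K Y) \<P>"
proof -
  let ?X = "subtopology K Y"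
  have top: "topspace ?X = Y" using gdelta_in_subset[OF Y(1)] by auto
  let ?Q = "\<lambda>b F. openin ?X b \<and> F = b" and ?R = "\<lambda>F S. F \<subseteq> ?X closure_of S"
  have step: "\<exists>\<C>. countable \<C> \<and> (\<forall>(b',F') \<in> \<C>. ?Q b' F' \<and> b' \<in> \<B> \<and> b' \<subseteq> b) \<and> ?R F (\<Union>(snd ` \<C>))"
    if \<B>: "base_of ?X \<B>" and Q: "?Q b F" for \<B> b F
  proof -
    let ?U = "{v \<in> \<B>. v \<subseteq> b}"
    have "\<forall>v\<in>?U. openin ?X v" using \<B> by (simp add: base_of_def)
    then obtain \<V> where V: "countable \<V>" "\<V> \<subseteq> ?U" "\<Union>?U \<subseteq> ?X closure_of \<Union>\<V>"
      using ccc_spaceE[OF ccc, of ?U "\<lambda>v. v"] by auto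
    have "b \<subseteq> \<Union>?U"
    proof
      fix x assume "x \<in> b"
      then obtain v where "v \<in> \<B>" "x \<in> v" "v \<subseteq> b" using base_ofE[OF \<B>] Q by metis
      then show "x \<in> \<Union>?U" by blast
    qed
    moreover have "\<Union>(snd ` (\<lambda>v. (v,v)) ` \<V>) = \<Union>\<V>" by (simp add: image_image)
    ultimately have "?R F (\<Union>(snd ` (\<lambda>v. (v,v)) ` \<V>))" using V Q by auto
    then show "\<exists>\<C>. countable \<C> \<and> (\<forall>(b',F') \<in> \<C>. ?Q b' F' \<and> b' \<in> \<B> \<and> b' \<subseteq> b) \<and> ?R F (\<Union>(snd ` \<C>))"
      using V \<B> by (intro exI[of _ "(\<lambda>v. (v,v)) ` \<V>"]) (auto simp: base_of_def)
  qed
  obtain \<N> \<H> where N: "countable \<N>" "\<And>b F. (b,F) \<in> \<N> \<Longrightarrow> ?Q b F"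
    and H: "countable \<H>" "\<And>F S. (F,S) \<in> \<H> \<Longrightarrow> ?R F S \<and> (\<exists>b. (b,F) \<in> \<N>) \<and> (\<exists>\<C>. \<C> \<subseteq> \<N> \<and> S = \<Union>(snd ` \<C>))"
    and fine: "\<And>x U. x \<in> topspace ?X \<Longrightarrow> \<forall>(F,S)\<in>\<H>. x \<in> F \<longrightarrow> x \<in> S \<Longrightarrow> openin ?X U \<Longrightarrow> x \<in> U \<Longrightarrow>
       \<exists>(b,F)\<in>\<N>. x \<in> b \<and> b \<subseteq> U"
    by (rule BCO_countable_tree[OF BCO _ _ step, of "topspace ?X" "topspace ?X"]) blast+
  \<comment> \<open>A point of \<open>D (F, S)\<close> is not lost at the node \<open>F\<close>; the set is open and dense since \<open>F\<close> lies in the closure of \<open>S\<close>.\<close>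
  define D where "D = (\<lambda>(F,S). (Y - ?X closure_of F) \<union> S)"
  have opFS: "openin ?X F" "openin ?X S" if FS: "(F,S) \<in> \<H>" for F S
  proof -
    show "openin ?X F" using H(2)[OF FS] N(2) by blast
    obtain \<C> where "\<C> \<subseteq> \<N>" "S = \<Union>(snd ` \<C>)" using H(2)[OF FS] by blast
    moreover from this have "\<forall>T\<in>snd ` \<C>. openin ?X T" using N(2) by fastforce
    ultimately show "openin ?X S" by blast
  qed
  have dense: "openin ?X T \<and> ?X closure_of T = Y" if T: "T \<in> D ` \<H>" for T
  proof -
    obtain F S where FS: "(F,S) \<in> \<H>" "T = (Y - ?X closure_of F) \<union> S" using T by (auto simp: D_def)
    have op: "openin ?X T" unfolding FS(2)
      using opFS[OF FS(1)] by (metis closedin_closure_of openin_Un openin_diff openin_topspace top)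
    have "?X closure_of F \<subseteq> ?X closure_of S"
      using H(2)[OF FS(1)] by (simp add: closure_of_minimal)
    moreover have "?X closure_of S \<subseteq> ?X closure_of T" using FS by (simp add: closure_of_mono)
    moreover have "T \<subseteq> ?X closure_of T" by (rule closure_of_subset[OF openin_subset[OF op]])
    ultimately have "Y \<subseteq> ?X closure_of T" using FS by blast
    then show ?thesis using op closure_of_subset_topspace[of ?X T] top by blast
  qed
  let ?P = "fst ` \<N> - {{}}"
  have "pi_base ?X ?P"
    unfolding pi_base_def
  proof (intro conjI allI impI)
    show "\<forall>P\<in>?P. openin ?X P \<and> P \<noteq> {}" using N(2) by force
    fix U assume U: "openin ?X U \<and> U \<noteq> {}"
    obtain x where x: "x \<in> U" "\<And>T. T \<in> D ` \<H> \<Longrightarrow> x \<in> T"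
      by (rule dense_gdelta_Baire[OF K Y _ dense, of "D ` \<H>" U]) (use H U in auto)
    have xY: "x \<in> topspace ?X" using x U openin_subset by blast
    have "x \<in> S" if "(F,S) \<in> \<H>" "x \<in> F" for F S
    proof -
      have "x \<in> ?X closure_of F"
        using that opFS by (meson closure_of_subset openin_subset subsetD)
      then show ?thesis using x(2)[of "D (F,S)"] that by (auto simp: D_def)
    qed
    then have "\<forall>(F,S)\<in>\<H>. x \<in> F \<longrightarrow> x \<in> S" by auto
    from fine[OF xY this _ x(1)] U have "\<exists>(b,F)\<in>\<N>. x \<in> b \<and> b \<subseteq> U" by simp
    then obtain b F where "(b,F) \<in> \<N>" "x \<in> b" "b \<subseteq> U" by auto
    moreover from this have "b \<in> fst ` \<N>" by (metis fst_conv image_eqI)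
    ultimately show "\<exists>P\<in>?P. P \<subseteq> U" by (intro bexI[of _ b]) auto
  qed
  moreover have "countable ?P" using N(1) by simp
  ultimately show thesis using that by blast
qed

section \<open>Topological groups with a countable \<open>\<pi>\<close>-base\<close>

lemma open_nbhd_Pair:
  fixes f :: "'a::topological_space \<times> 'b::topological_space \<Rightarrow> 'c::topological_space"
  assumes f: "continuous_on UNIV f" and U: "open U" "f (a,b) \<in> U"
  obtains A B where "open A" "open B" "a \<in> A" "b \<in> B" "\<And>x y. x \<in> A \<Longrightarrow> y \<in> B \<Longrightarrow> f (x,y) \<in> U"
proof -
  have "open (f -` U)" using open_vimage[OF U(1) f] .
  moreover have "(a,b) \<in> f -` U" using U(2) by simp
  ultimately obtain A B where AB: "open A" "open B" "(a,b) \<in> A \<times> B" "A \<times> B \<subseteq> f -` U"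
    by (rule open_prod_elim)
  then show thesis by (intro that[of A B]) auto
qed

lemma open_group_vimage:
  fixes U :: "'g::{topological_group_add,t2_space} set"
  assumes "open U"
  shows "open {x. a + x \<in> U}" "open {x. x + a \<in> U}" "open {x. - x + a \<in> U}"
  using open_vimage[OF assms, of "\<lambda>x. a + x"] open_vimage[OF assms, of "\<lambda>x. x + a"]
    open_vimage[OF assms, of "\<lambda>x. - x + a"]
  by (simp_all add: vimage_def continuous_intros)

text \<open>In a topological group the differences \<open>P - P\<close>, for \<open>P\<close> in a \<open>\<pi>\<close>-base, form a base at \<open>0\<close>: if
  \<open>W - W \<subseteq> U\<close>, it suffices to choose \<open>P\<close> inside \<open>W\<close>. So the \<open>\<pi>\<close>-character and the character coincide.\<close>

lemma group_pi_base_imp_countable_nbhd_base: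
  fixes \<P> :: "'g::{topological_group_add,t2_space} set set"
  assumes P: "countable \<P>" "pi_base euclidean \<P>"
  obtains N :: "nat \<Rightarrow> 'g set" where "\<And>n. open (N n)" "\<And>n. 0 \<in> N n"
    "\<And>U. open U \<Longrightarrow> 0 \<in> U \<Longrightarrow> \<exists>n. N n \<subseteq> U"
proof -
  define D where "D P = (\<Union>q\<in>P. {x::'g. x + q \<in> P})" for P
  have ne: "\<P> \<noteq> {}" using P(2) unfolding pi_base_def by (metis UNIV_not_empty empty_iff open_UNIV open_openin)
  have op: "open P" "P \<noteq> {}" if "P \<in> \<P>" for P using P(2) that by (auto simp: pi_base_def)
  have in_range: "from_nat_into \<P> n \<in> \<P>" for n using ne by (rule from_nat_into)
  show thesis
  proof
    fix n
    show "open (D (from_nat_into \<P> n))" unfolding D_def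
      by (intro open_UN ballI open_group_vimage op in_range)
    show "0 \<in> D (from_nat_into \<P> n)" using op(2)[OF in_range[of n]] by (auto simp: D_def)
  next
    fix U :: "'g set" assume U: "open U" "0 \<in> U"
    have "continuous_on UNIV (\<lambda>z::'g\<times>'g. fst z + - snd z)" by (intro continuous_intros)
    then obtain A B where AB: "open A" "open B" "0 \<in> A" "0 \<in> B" "\<And>x y. x \<in> A \<Longrightarrow> y \<in> B \<Longrightarrow> x - y \<in> U"
      by (rule open_nbhd_Pair[where a=0 and b=0 and U=U]) (use U in auto)
    have "openin euclidean (A \<inter> B)" "A \<inter> B \<noteq> {}" using AB by auto
    then obtain P where P': "P \<in> \<P>" "P \<subseteq> A \<inter> B" using P(2) unfolding pi_base_def by metis
    have "D P \<subseteq> U"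
    proof
      fix x assume "x \<in> D P"
      then obtain q where "q \<in> P" "x + q \<in> P" by (auto simp: D_def)
      then have "x + q - q \<in> U" using AB(5) P' by blast
      then show "x \<in> U" by simp
    qed
    moreover obtain n where "P = from_nat_into \<P> n" using P'(1) P(1) by (metis from_nat_into_surj)
    ultimately show "\<exists>n. D (from_nat_into \<P> n) \<subseteq> U" by blast
  qed
qed

text \<open>One point from each member of the \<open>\<pi>\<close>-base gives a countable dense set; its translates of a
  countable base at \<open>0\<close> form a base.\<close>

lemma group_pi_base_imp_second_countable:
  fixes \<P> :: "'g::{topological_group_add,t2_space} set set"
  assumes P: "countable \<P>" "pi_base euclidean \<P>"
  shows "second_countable (euclidean :: 'g topology)"
proof -
  obtain N :: "nat \<Rightarrow> 'g set" where N: "\<And>n. open (N n)" "\<And>n. 0 \<in> N n"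
    "\<And>U. open U \<Longrightarrow> 0 \<in> U \<Longrightarrow> \<exists>n. N n \<subseteq> U"
    using group_pi_base_imp_countable_nbhd_base[OF P] by metis
  define d where "d P = (SOME x::'g. x \<in> P)" for P
  have d: "d P \<in> P" if "P \<in> \<P>" for P
    using P(2) that unfolding pi_base_def d_def by (metis some_in_eq)
  define B where "B = (\<lambda>(P,n). {x. - d P + x \<in> N n})"
  have fine: "\<exists>V\<in>B ` (\<P> \<times> UNIV). x \<in> V \<and> V \<subseteq> U" if U: "open U" "x \<in> U" for U x
  proof -
    \<comment> \<open>If \<open>d = x - u\<close> and \<open>y = d + v\<close> with small \<open>u\<close> and \<open>v\<close>, then \<open>y = x - u + v\<close> is near \<open>x\<close>.\<close>
    have "continuous_on UNIV (\<lambda>z. x + - fst z + snd z)" by (intro continuous_intros)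
    then obtain A C where AC: "open A" "open C" "0 \<in> A" "0 \<in> C" "\<And>u v. u \<in> A \<Longrightarrow> v \<in> C \<Longrightarrow> x - u + v \<in> U"
      by (rule open_nbhd_Pair[where a=0 and b=0 and U=U]) (use U in auto)
    then obtain n where n: "N n \<subseteq> A \<inter> C" using N(3)[of "A \<inter> C"] by auto
    have "open {y. - y + x \<in> N n}" by (rule open_group_vimage[OF N(1)])
    moreover have "x \<in> {y. - y + x \<in> N n}" using N(2) by simp
    ultimately obtain P where P': "P \<in> \<P>" "P \<subseteq> {y. - y + x \<in> N n}"
      using P(2) unfolding pi_base_def by (metis empty_iff open_openin)
    then have dx: "- d P + x \<in> N n" using d by force
    have "B (P,n) \<subseteq> U"
    proof
      fix y assume "y \<in> B (P,n)"
      then have "- d P + y \<in> N n" by (simp add: B_def)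
      then have "x - (- d P + x) + (- d P + y) \<in> U" using dx n AC(5) by blast
      moreover have "x - (- d P + x) + (- d P + y) = y"
        by (simp add: diff_conv_add_uminus minus_add add.assoc del: add_uminus_conv_diff)
      ultimately show "y \<in> U" by simp
    qed
    moreover have "x \<in> B (P,n)" using dx by (simp add: B_def)
    ultimately show ?thesis using P'(1) by blast
  qed
  show ?thesis
    unfolding second_countable_def
  proof (intro exI[of _ "B ` (\<P> \<times> UNIV)"] conjI allI impI ballI)
    show "countable (B ` (\<P> \<times> (UNIV::nat set)))" using P(1) by simp
    show "openin euclidean V" if "V \<in> B ` (\<P> \<times> UNIV)" for V
    proof -
      obtain P n where "V = {x. - d P + x \<in> N n}" using \<open>V \<in> _\<close> by (auto simp: B_def)
      then show ?thesis using open_group_vimage(1)[OF N(1), of "- d P" n] by simp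
    qed
  qed (use fine in auto)
qed

section \<open>Chain condition for \<open>\<sigma>\<close>-compact groups\<close>

lemma compact_group_totally_bounded:
  fixes C :: "'g::{topological_group_add,t2_space} set"
  assumes C: "compact C" "A \<subseteq> C" and W: "open W" "0 \<in> W"
  obtains S where "finite S" "S \<subseteq> A" "\<And>x. x \<in> A \<Longrightarrow> \<exists>a\<in>S. - a + x \<in> W"
proof -
  have "continuous_on UNIV (\<lambda>z::'g\<times>'g. - fst z + snd z)" by (intro continuous_intros)
  then obtain M M' where M: "open M" "open M'" "0 \<in> M" "0 \<in> M'" "\<And>u v. u \<in> M \<Longrightarrow> v \<in> M' \<Longrightarrow> - u + v \<in> W"
    by (rule open_nbhd_Pair[where a=0 and b=0 and U=W]) (use W in auto)
  define N where "N c = {x::'g. - c + x \<in> M \<inter> M'}" for c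
  obtain T where T: "T \<subseteq> C" "finite T" "C \<subseteq> (\<Union>c\<in>T. N c)"
  proof (rule compactE_image[OF C(1), of C N])
    show "open (N c)" for c unfolding N_def using M by (intro open_group_vimage) auto
    show "C \<subseteq> (\<Union>c\<in>C. N c)" using M by (auto simp: N_def)
  qed
  define a where "a c = (SOME x. x \<in> A \<inter> N c)" for c
  let ?T = "{c \<in> T. A \<inter> N c \<noteq> {}}"
  have a: "a c \<in> A \<inter> N c" if "c \<in> ?T" for c 
    unfolding a_def by (rule someI_ex) (use that in blast)
  show thesis
  proof
    show "finite (a ` ?T)" using T by simp
    show "a ` ?T \<subseteq> A" using a by blast
    fix x assume x: "x \<in> A"
    then obtain c where c: "c \<in> T" "x \<in> N c" using C T by blast
    then have "c \<in> ?T" using x by blast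
    then have "- c + a c \<in> M" "- c + x \<in> M'" using a[of c] c by (auto simp: N_def)
    then have "- (- c + a c) + (- c + x) \<in> W" using M by blast
    moreover have "- (- c + a c) + (- c + x) = - a c + x" by (simp add: minus_add add.assoc)
    ultimately show "\<exists>b\<in>a ` ?T. - b + x \<in> W" using \<open>c \<in> ?T\<close> by auto
  qed
qed

text \<open>This is the core of the chain condition for \<open>\<sigma>\<close>-compact groups. It rests on the ternary operation
  \<open>(a, y, x) \<mapsto> a - y + x\<close>, for which \<open>a - y + x\<close> is close to \<open>a\<close> when \<open>y\<close> is close to \<open>x\<close>, and close to
  \<open>x\<close> when \<open>y\<close> is close to \<open>a\<close>. The countable set \<open>I\<close> is closed off so that every \<open>x \<in> A\<close> is imitated
  in \<open>I\<close>, with respect to any finitely many of the neighbourhoods belonging to members of \<open>I\<close>. By compactness the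
  imitations of \<open>x\<close> accumulate at a point \<open>y\<close>, which then is close to \<open>x\<close> with respect to all
  neighbourhoods belonging to members of \<open>I\<close> simultaneously. Since \<open>y\<close> is a limit of members of \<open>I\<close>, some \<open>a \<in> I\<close> is so
  close to \<open>y\<close> that \<open>a - y + x\<close> is near \<open>x\<close>, while \<open>a - y + x\<close> also lies in the neighbourhood
  of \<open>a\<close>.\<close>

lemma compact_group_countable_dense_union:
  fixes C :: "'g::{topological_group_add,t2_space} set"
  assumes C: "compact C" "A \<subseteq> C" and V: "\<And>a. a \<in> A \<Longrightarrow> open (V a) \<and> 0 \<in> V a"
  obtains I where "countable I" "I \<subseteq> A" "A \<subseteq> closure (\<Union>a\<in>I. {y. - a + y \<in> V a})"
proof -
  have "\<exists>W. open W \<and> 0 \<in> W \<and> (\<forall>u\<in>W. \<forall>v\<in>W. u + v \<in> V a)" if a: "a \<in> A" for a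
  proof -
    have "continuous_on UNIV (\<lambda>z::'g\<times>'g. fst z + snd z)" by (intro continuous_intros)
    then obtain M M' where M: "open M" "open M'" "0 \<in> M" "0 \<in> M'" "\<And>u v. u \<in> M \<Longrightarrow> v \<in> M' \<Longrightarrow> u + v \<in> V a"
      by (rule open_nbhd_Pair[where a=0 and b=0 and U="V a"]) (use V[OF a] in auto)
    then show ?thesis by (intro exI[of _ "M \<inter> M'"]) auto
  qed
  then obtain W where W: "\<And>a. a \<in> A \<Longrightarrow> open (W a) \<and> 0 \<in> W a \<and> (\<forall>u\<in>W a. \<forall>v\<in>W a. u + v \<in> V a)"
    by metis
  have "\<exists>S. finite S \<and> S \<subseteq> A \<and> (\<forall>x\<in>A. \<exists>a\<in>S. \<forall>f\<in>F. - a + x \<in> W f)" if F: "finite F" "F \<subseteq> A" for F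
  proof -
    have "open (\<Inter>f\<in>F. W f)" using F W by (intro open_INT) auto
    moreover have "0 \<in> (\<Inter>f\<in>F. W f)" using F W by auto
    ultimately obtain S where "finite S" "S \<subseteq> A" "\<And>x. x \<in> A \<Longrightarrow> \<exists>a\<in>S. - a + x \<in> (\<Inter>f\<in>F. W f)"
      by (rule compact_group_totally_bounded[OF C]) blast
    then show ?thesis by (intro exI[of _ S]) auto
  qed
  then obtain S where S: "\<And>F. finite F \<Longrightarrow> F \<subseteq> A \<Longrightarrow> finite (S F) \<and> S F \<subseteq> A \<and>
      (\<forall>x\<in>A. \<exists>a\<in>S F. \<forall>f\<in>F. - a + x \<in> W f)"
    by metis
  \<comment> \<open>Closing off: \<open>J (n + 1)\<close> imitates all points of \<open>A\<close> with respect to the finite subsets of \<open>J n\<close>.\<close>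
  define J where "J = rec_nat {} (\<lambda>n I. I \<union> \<Union>(S ` {F. finite F \<and> F \<subseteq> I}))"
  have J0: "J 0 = {}" and JS: "\<And>n. J (Suc n) = J n \<union> \<Union>(S ` {F. finite F \<and> F \<subseteq> J n})"
    by (simp_all add: J_def)
  have JA: "J n \<subseteq> A \<and> countable (J n)" for n
  proof (induction n)
    case (Suc n)
    have "countable (S F)" "S F \<subseteq> A" if "finite F" "F \<subseteq> J n" for F
    proof -
      have "F \<subseteq> A" using that Suc by auto
      then show "countable (S F)" "S F \<subseteq> A" using S[OF that(1)] by (auto intro: countable_finite)
    qed
    then have "J (Suc n) \<subseteq> A" using Suc unfolding JS by blast
    moreover have "countable (J (Suc n))" unfolding JS
      using Suc \<open>\<And>F. \<lbrakk>finite F; F \<subseteq> J n\<rbrakk> \<Longrightarrow> countable (S F)\<close>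
      by (intro countable_Un countable_UN countable_Collect_finite_subset) auto
    ultimately show ?case by blast
  qed (simp add: J0)
  define I where "I = (\<Union>n. J n)"
  have IA: "I \<subseteq> A" "countable I" using JA by (auto simp: I_def)
  have "mono J" by (auto simp: mono_iff_le_Suc JS)
  have SI: "S F \<subseteq> I" if F: "finite F" "F \<subseteq> I" for F
  proof -
    have "\<exists>n. F \<subseteq> J n" using F
    proof (induction F)
      case (insert x F)
      then obtain n m where "F \<subseteq> J n" "x \<in> J m" by (auto simp: I_def)
      then have "insert x F \<subseteq> J (max n m)"
        using monoD[OF \<open>mono J\<close>, of n "max n m"] monoD[OF \<open>mono J\<close>, of m "max n m"] by auto
      then show ?case by blast
    qed simp
    then obtain n where "F \<subseteq> J n" by blast
    then have "S F \<subseteq> J (Suc n)" using F unfolding JS by blast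
    then show ?thesis by (auto simp: I_def)
  qed
  have "x \<in> closure (\<Union>a\<in>I. {y. - a + y \<in> V a})" if x: "x \<in> A" for x
  proof -
    \<comment> \<open>The imitations of \<open>x\<close> with respect to \<open>F\<close>; the sets \<open>T F\<close> are directed downwards.\<close>
    define T where "T F = {a \<in> I. \<forall>f\<in>F. - a + x \<in> W f}" for F
    have "C \<inter> (\<Inter>F\<in>{F. finite F \<and> F \<subseteq> I}. closure (T F)) \<noteq> {}"
    proof (rule compact_imp_fip_image[OF C(1)])
      show "closed (closure (T F))" for F by simp
      fix \<F> assume \<F>: "finite \<F>" "\<F> \<subseteq> {F. finite F \<and> F \<subseteq> I}"
      then have fin: "finite (\<Union>\<F>)" "\<Union>\<F> \<subseteq> I" by auto
      then obtain a where a: "a \<in> S (\<Union>\<F>)" "\<forall>f\<in>\<Union>\<F>. - a + x \<in> W f"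
        using S[of "\<Union>\<F>"] x IA by blast
      then have "a \<in> I" using SI[OF fin] by blast
      then have "a \<in> T F" if "F \<in> \<F>" for F using a that by (auto simp: T_def)
      then have "a \<in> C \<inter> (\<Inter>F\<in>\<F>. closure (T F))" using closure_subset \<open>a \<in> I\<close> IA C by blast
      then show "C \<inter> (\<Inter>F\<in>\<F>. closure (T F)) \<noteq> {}" by blast
    qed
    then obtain y where y: "\<And>F. finite F \<Longrightarrow> F \<subseteq> I \<Longrightarrow> y \<in> closure (T F)" by blast
    have hit: "\<exists>a\<in>S. a \<in> Q" if "y \<in> closure S" "open Q" "y \<in> Q" for S Q
      using that open_Int_closure_eq_empty[of Q S] by blast
    have "\<exists>p\<in>(\<Union>a\<in>I. {y. - a + y \<in> V a}). p \<in> Q" if Q: "open Q" "x \<in> Q" for Q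
    proof -
      have "open {u. u + (- y + x) \<in> Q}" by (rule open_group_vimage[OF Q(1)])
      moreover have "y \<in> {u. u + (- y + x) \<in> Q}" using Q by (simp add: add.assoc[symmetric])
      ultimately obtain a where a: "a \<in> T {}" "a + (- y + x) \<in> Q"
        using hit[OF y[of "{}"]] by force
      then have aI: "a \<in> I" by (simp add: T_def)
      then have Wa: "open (W a)" "0 \<in> W a" "\<And>u v. u \<in> W a \<Longrightarrow> v \<in> W a \<Longrightarrow> u + v \<in> V a"
        using W IA by auto
      \<comment> \<open>Passing to the limit \<open>y\<close> costs one more neighbourhood, which is why \<open>W a + W a \<subseteq> V a\<close> was required.\<close>
      have "open {u. - y + u \<in> W a}" by (rule open_group_vimage[OF Wa(1)])
      moreover have "y \<in> {u. - y + u \<in> W a}" using Wa by simp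
      ultimately obtain a' where a': "a' \<in> T {a}" "- y + a' \<in> W a"
        using hit[OF y[of "{a}"]] aI by force
      then have "- a' + x \<in> W a" by (simp add: T_def)
      then have "(- y + a') + (- a' + x) \<in> V a" using a' Wa(3) by blast
      then have "- y + x \<in> V a" by (simp add: add.assoc)
      then have "- a + (a + (- y + x)) \<in> V a" by (simp only: minus_add_cancel)
      then show ?thesis using a aI by blast
    qed
    then have meet: "\<exists>p\<in>S'. p \<in> Q" if "open Q" "x \<in> Q" "S' = (\<Union>a\<in>I. {y. - a + y \<in> V a})" for Q S'
      using that by simp
    show ?thesis
    proof (rule ccontr)
      assume "x \<notin> closure (\<Union>a\<in>I. {y. - a + y \<in> V a})" (is "x \<notin> closure ?S")
      then obtain p where "p \<in> ?S" "p \<in> - closure ?S"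
        using meet[of "- closure ?S", OF _ _ refl] by auto
      then show False using closure_subset[of ?S] by blast
    qed
  qed
  then show thesis using that IA by blast
qed

text \<open>Tkachenko's theorem. The members of \<open>\<U>\<close>, translated to \<open>0\<close>, serve as the neighbourhoods \<open>V a\<close> of the
  preceding lemma, which is applied to each compact piece separately.\<close>

lemma sigma_compact_group_ccc:
  fixes C :: "nat \<Rightarrow> 'g::{topological_group_add,t2_space} set"
  assumes C: "\<And>n. compact (C n)" "(\<Union>n. C n) = UNIV"
  shows "ccc_space (euclidean :: 'g topology)"
  unfolding ccc_space_def
proof (intro allI impI)
  fix \<U> :: "'g set set" assume \<U>: "\<forall>U\<in>\<U>. openin euclidean U"
  have "\<forall>x\<in>\<Union>\<U>. \<exists>U\<in>\<U>. x \<in> U" by blast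
  then obtain u where u: "\<And>x. x \<in> \<Union>\<U> \<Longrightarrow> u x \<in> \<U> \<and> x \<in> u x" by metis
  have "\<exists>I. countable I \<and> I \<subseteq> \<Union>\<U> \<and> C n \<inter> \<Union>\<U> \<subseteq> closure (\<Union>(u ` I))" for n
  proof -
    obtain I where I: "countable I" "I \<subseteq> C n \<inter> \<Union>\<U>"
      "C n \<inter> \<Union>\<U> \<subseteq> closure (\<Union>a\<in>I. {y. - a + y \<in> {v. a + v \<in> u a}})"
    proof (rule compact_group_countable_dense_union[OF C(1)[of n], of "C n \<inter> \<Union>\<U>" "\<lambda>a. {v. a + v \<in> u a}"])
      show "open {v. a + v \<in> u a} \<and> 0 \<in> {v. a + v \<in> u a}" if "a \<in> C n \<inter> \<Union>\<U>" for a
        using u[of a] that \<U> open_group_vimage(1)[of "u a" a] by auto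
    qed auto
    moreover have "(\<Union>a\<in>I. {y. - a + y \<in> {v. a + v \<in> u a}}) = \<Union>(u ` I)"
      by (auto simp: add.assoc[symmetric])
    ultimately show ?thesis by auto
  qed
  then obtain I where I: "\<And>n. countable (I n) \<and> I n \<subseteq> \<Union>\<U> \<and> C n \<inter> \<Union>\<U> \<subseteq> closure (\<Union>(u ` I n))"
    by metis
  let ?V = "u ` (\<Union>n. I n)"
  have "\<Union>\<U> \<subseteq> closure (\<Union>?V)"
  proof
    fix x assume x: "x \<in> \<Union>\<U>"
    obtain n where "x \<in> C n" using C(2) by blast
    then have "x \<in> closure (\<Union>(u ` I n))" using I x by blast
    moreover have "closure (\<Union>(u ` I n)) \<subseteq> closure (\<Union>?V)" by (intro closure_mono) blast
    ultimately show "x \<in> closure (\<Union>?V)" by blast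
  qed
  moreover have "countable ?V" using I by simp
  moreover have "?V \<subseteq> \<U>"
  proof
    fix v assume "v \<in> ?V"
    then obtain n a where "a \<in> I n" "v = u a" by blast
    then show "v \<in> \<U>" using I[of n] u[of a] by auto
  qed
  ultimately show "\<exists>\<V>. countable \<V> \<and> \<V> \<subseteq> \<U> \<and> \<Union>\<U> \<subseteq> euclidean closure_of \<Union>\<V>"
    by (intro exI[of _ ?V]) (simp add: euclidean_closure_of)
qed

section \<open>Compact sets of countable character\<close>

definition countable_character :: "'a topology \<Rightarrow> 'a set \<Rightarrow> bool" where
  "countable_character X D \<longleftrightarrow> (\<exists>W :: nat \<Rightarrow> 'a set. (\<forall>n. openin X (W n) \<and> D \<subseteq> W n) \<and>
     (\<forall>U. openin X U \<and> D \<subseteq> U \<longrightarrow> (\<exists>n. W n \<subseteq> U)))"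

lemma countable_characterE:
  assumes "countable_character X D"
  obtains W :: "nat \<Rightarrow> 'a set" where "\<And>n. openin X (W n)" "\<And>n. D \<subseteq> W n"
    "\<And>U. openin X U \<Longrightarrow> D \<subseteq> U \<Longrightarrow> \<exists>n. W n \<subseteq> U"
proof -
  obtain W :: "nat \<Rightarrow> 'a set" where "\<forall>n. openin X (W n) \<and> D \<subseteq> W n"
    "\<forall>U. openin X U \<and> D \<subseteq> U \<longrightarrow> (\<exists>n. W n \<subseteq> U)"
    using assms unfolding countable_character_def by (elim exE conjE)
  then show thesis by (intro that[of W]) simp_all
qed

definition countable_type :: "'a topology \<Rightarrow> bool" where
  "countable_type X \<longleftrightarrow> (\<forall>C. compactin X C \<longrightarrow> (\<exists>D. C \<subseteq> D \<and> compactin X D \<and> countable_character X D))"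

text \<open>Regularity allows the open sets defining \<open>P\<close> to be shrunk around \<open>z\<close> to a sequence in which each set
  contains the closure of the next. The intersection of such a sequence is closed, and by compactness
  the sequence is a neighbourhood base of it.\<close>

lemma gdelta_point_countable_character:
  assumes K: "compact_space K" "Hausdorff_space K" and P: "gdelta_in K P" "z \<in> P"
  obtains F where "closedin K F" "z \<in> F" "F \<subseteq> P" "countable_character K F"
proof -
  have reg: "regular_space K" using K by (simp add: compact_Hausdorff_imp_regular_space)
  obtain O' where O': "\<And>n::nat. openin K (O' n)" "\<Inter>(range O') = P"
    using P(1) unfolding gdelta_in_descending by blast
  have zO: "z \<in> O' n" for n using P(2) O'(2) by blast
  have "\<exists>V. \<forall>n. (openin K (V n) \<and> z \<in> V n \<and> V n \<subseteq> O' n) \<and> K closure_of (V (Suc n)) \<subseteq> V n"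
  proof (rule dependent_nat_choice)
    show "\<exists>V. openin K V \<and> z \<in> V \<and> V \<subseteq> O' 0" using O'(1) zO by blast
    fix V n assume V: "openin K V \<and> z \<in> V \<and> V \<subseteq> O' n"
    then have "openin K (V \<inter> O' (Suc n))" "z \<in> V \<inter> O' (Suc n)" using O'(1) zO by auto
    from regular_space_closure_nbhd[OF reg this] obtain V' where
      V': "openin K V'" "z \<in> V'" "K closure_of V' \<subseteq> V \<inter> O' (Suc n)" .
    moreover have "V' \<subseteq> K closure_of V'" by (rule closure_of_subset[OF openin_subset[OF V'(1)]])
    ultimately show "\<exists>V'. (openin K V' \<and> z \<in> V' \<and> V' \<subseteq> O' (Suc n)) \<and> K closure_of V' \<subseteq> V" by blast
  qed
  then obtain V where V: "\<And>n. openin K (V n)" "\<And>n. z \<in> V n" "\<And>n. V n \<subseteq> O' n"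
    "\<And>n. K closure_of (V (Suc n)) \<subseteq> V n" by blast
  have cl: "V n \<subseteq> K closure_of (V n)" for n by (rule closure_of_subset[OF openin_subset[OF V(1)]])
  define F where "F = (\<Inter>n. K closure_of (V n))"
  have FV: "F \<subseteq> V n" for n using V(4)[of n] by (auto simp: F_def)
  show thesis
  proof
    show "closedin K F" unfolding F_def by (intro closedin_INT) auto
    show "z \<in> F" using V(2) cl by (auto simp: F_def)
    show "F \<subseteq> P" using FV V(3) O'(2) by blast
    have "\<exists>n. V n \<subseteq> W" if W: "openin K W" "F \<subseteq> W" for W
    proof (rule ccontr)
      assume no: "\<nexists>n. V n \<subseteq> W"
      have "(\<Inter>n. K closure_of (V n) - W) \<noteq> {}"
      proof (rule compact_space_imp_nest[OF K(1)])
        show "closedin K (K closure_of (V n) - W)" for n using W(1) by (simp add: closedin_diff)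
        show "K closure_of (V n) - W \<noteq> {}" for n using no cl by blast
        show "decseq (\<lambda>n. K closure_of (V n) - W)"
          using cl V(4) by (intro decseq_SucI) blast
      qed
      then show False using W(2) by (auto simp: F_def)
    qed
    then show "countable_character K F"
      unfolding countable_character_def using V(1) FV by (intro exI[of _ V]) simp
  qed
qed

lemma embedding_map_countable_character:
  assumes e: "embedding_map X K e" and F: "F \<subseteq> e ` topspace X" and c: "countable_character K F"
  shows "countable_character X {x \<in> topspace X. e x \<in> F}"
proof -
  have cont: "continuous_map X K e"
    by (rule embedding_map_continuous_map[OF e])
  obtain V :: "nat \<Rightarrow> _" where V: "\<And>n. openin K (V n)" "\<And>n. F \<subseteq> V n"
      "\<And>U. openin K U \<Longrightarrow> F \<subseteq> U \<Longrightarrow> \<exists>n. V n \<subseteq> U"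
    using countable_characterE[OF c] by metis
  show ?thesis
    unfolding countable_character_def
  proof (intro exI[of _ "\<lambda>n. {x \<in> topspace X. e x \<in> V n}"] conjI allI impI)
    fix n show "openin X {x \<in> topspace X. e x \<in> V n}"
      using cont V(1) by (simp add: openin_continuous_map_preimage)
    show "{x \<in> topspace X. e x \<in> F} \<subseteq> {x \<in> topspace X. e x \<in> V n}" using V(2) by blast
  next
    fix U assume U: "openin X U \<and> {x \<in> topspace X. e x \<in> F} \<subseteq> U"
    then obtain T where T: "openin K T" "U = {x \<in> topspace X. e x \<in> T}"
      using embedding_map_open_image[OF e] by metis
    then have "F \<subseteq> T" using F U by blast
    then obtain n where "V n \<subseteq> T" using V(3) T(1) by blast
    then show "\<exists>n. {x \<in> topspace X. e x \<in> V n} \<subseteq> U" using T(2) by blast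
  qed
qed

text \<open>A neighbourhood base \<open>W n\<close> of a compact set \<open>D\<close> in a dense subspace controls \<open>D\<close> in the whole space:
  the closures of the complements of the \<open>W n\<close> miss \<open>D\<close>, and they exhaust its complement because a point
  off \<open>D\<close> has a neighbourhood whose closure misses \<open>D\<close>, hence whose trace misses some \<open>W n\<close>.\<close>

lemma countable_character_dense_embedding:
  assumes K: "Hausdorff_space K" "regular_space K" and e: "embedding_map X K e"
    and d: "K closure_of (e ` topspace X) = topspace K"
    and D: "compactin X D" "countable_character X D"
  obtains C :: "nat \<Rightarrow> _" where "\<And>n. closedin K (C n)" "(\<Union>n. C n) = topspace K - e ` D"
proof -
  have cont: "continuous_map X K e"
    by (rule embedding_map_continuous_map[OF e])
  have DX: "D \<subseteq> topspace X" using D(1) by (rule compactin_subset_topspace)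
  obtain W :: "nat \<Rightarrow> _" where W: "\<And>n. openin X (W n)" "\<And>n. D \<subseteq> W n"
      "\<And>U. openin X U \<Longrightarrow> D \<subseteq> U \<Longrightarrow> \<exists>n. W n \<subseteq> U"
    using countable_characterE[OF D(2)] by metis
  define C where "C n = K closure_of (e ` (topspace X - W n))" for n
  have "closedin K (e ` D)"
    using image_compactin[OF D(1) cont] K(1) compactin_imp_closedin by blast
  have sub: "C n \<subseteq> topspace K - e ` D" for n
  proof -
    obtain T where T: "openin K T" "W n = {x \<in> topspace X. e x \<in> T}"
      using embedding_map_open_image[OF e] W(1) by metis
    have "e x \<notin> C n" if "x \<in> D" for x
    proof
      assume "e x \<in> C n"
      moreover have "e x \<in> T" using that W(2)[of n] T(2) by blast
      ultimately obtain y where "y \<in> e ` (topspace X - W n)" "y \<in> T"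
        unfolding C_def using closure_ofE[OF _ T(1)] by metis
      then show False using T(2) by blast
    qed
    moreover have "C n \<subseteq> topspace K" unfolding C_def by (rule closure_of_subset_topspace)
    ultimately show ?thesis by blast
  qed
  have "y \<in> (\<Union>n. C n)" if y: "y \<in> topspace K - e ` D" for y
  proof -
    have "openin K (topspace K - e ` D)" using \<open>closedin K (e ` D)\<close> by blast
    then obtain V' where V': "openin K V'" "y \<in> V'" "K closure_of V' \<subseteq> topspace K - e ` D"
      using regular_space_closure_nbhd[OF K(2) _ y] by metis
    let ?V = "{x \<in> topspace X. e x \<in> topspace K - K closure_of V'}"
    have "openin X ?V" using cont by (intro openin_continuous_map_preimage) auto
    moreover have "D \<subseteq> ?V"
      using V'(3) DX continuous_map_image_subset_topspace[OF cont] by blast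
    ultimately obtain n where n: "W n \<subseteq> ?V" using W(3) by blast
    have "y \<in> C n"
      unfolding C_def in_closure_of
    proof (intro conjI allI impI)
      show "y \<in> topspace K" using y by blast
      fix T assume "y \<in> T \<and> openin K T"
      then have T: "openin K (T \<inter> V')" "y \<in> T \<inter> V'" using V' by auto
      have "y \<in> K closure_of (e ` topspace X)" unfolding d using y by blast
      then obtain w where "w \<in> e ` topspace X" "w \<in> T \<inter> V'" using T by (rule closure_ofE)
      then obtain x where x: "x \<in> topspace X" "e x \<in> T" "e x \<in> V'" by blast
      have "V' \<subseteq> K closure_of V'" by (rule closure_of_subset[OF openin_subset[OF V'(1)]])
      then have "x \<notin> W n" using n x by blast
      then show "\<exists>w. w \<in> e ` (topspace X - W n) \<and> w \<in> T" using x by blast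
    qed
    then show ?thesis by blast
  qed
  then have "(\<Union>n. C n) = topspace K - e ` D" using sub by blast
  moreover have "closedin K (C n)" for n by (simp add: C_def)
  ultimately show thesis using that by blast
qed

text \<open>One half of the Henriksen-Isbell theorem. The part of \<open>K\<close> that is missed by an open cover of the remainder is a
  compact subset of \<open>X\<close>; enclosed in a compact \<open>D \<subseteq> X\<close> of countable character, its complement
  becomes a union of countably many compact sets, each of which needs only finitely many members of the cover.\<close>

lemma countable_type_imp_Lindelof_remainder:
  assumes K: "compact_space K" "Hausdorff_space K" and e: "embedding_map X K e"
    and d: "K closure_of (e ` topspace X) = topspace K" and X: "countable_type X"
  shows "Lindelof_space (subtopology K (topspace K - e ` topspace X))"
proof -
  let ?Y = "topspace K - e ` topspace X"
  have reg: "regular_space K" using K by (simp add: compact_Hausdorff_imp_regular_space)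
  have "\<exists>\<V>. countable \<V> \<and> \<V> \<subseteq> \<U> \<and> ?Y \<subseteq> \<Union>\<V>" if \<U>: "\<forall>U\<in>\<U>. openin K U" "?Y \<subseteq> \<Union>\<U>" for \<U>
  proof -
    let ?C = "topspace K - \<Union>\<U>"
    have "openin K (\<Union>\<U>)" using \<U>(1) by blast
    then have "compactin K ?C" using K(1) by (simp add: closedin_compact_space closedin_diff)
    moreover have CX: "?C \<subseteq> e ` topspace X" using \<U>(2) by blast
    ultimately have "compactin X {x \<in> topspace X. e x \<in> ?C}"
      using embedding_map_preimage_compactin[OF e] by blast
    then obtain D where D: "{x \<in> topspace X. e x \<in> ?C} \<subseteq> D" "compactin X D" "countable_character X D"
      using X[unfolded countable_type_def] by meson
    obtain C :: "nat \<Rightarrow> _" where C: "\<And>n. closedin K (C n)" "(\<Union>n. C n) = topspace K - e ` D"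
      using countable_character_dense_embedding[OF K(2) reg e d D(2,3)] by metis
    have CD: "?C \<subseteq> e ` D" using CX D(1) by blast
    have "\<exists>\<F>. finite \<F> \<and> \<F> \<subseteq> \<U> \<and> C n \<subseteq> \<Union>\<F>" for n
    proof -
      have "C n \<subseteq> \<Union>\<U>" using CD C(2) by blast
      moreover have "compactin K (C n)" using K(1) C(1) closedin_compact_space by blast
      ultimately show ?thesis using \<U>(1) unfolding compactin_def by metis
    qed
    then have "\<forall>n. \<exists>\<F>. finite \<F> \<and> \<F> \<subseteq> \<U> \<and> C n \<subseteq> \<Union>\<F>" by blast
    from choice[OF this] obtain \<F> where \<F>: "\<And>n. finite (\<F> n)" "\<And>n. \<F> n \<subseteq> \<U>" "\<And>n. C n \<subseteq> \<Union>(\<F> n)"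
      by blast
    have "?Y \<subseteq> (\<Union>n. C n)" using compactin_subset_topspace[OF D(2)] unfolding C(2) by blast
    also have "\<dots> \<subseteq> \<Union>(\<Union>n. \<F> n)" using \<F>(3) by blast
    finally have "?Y \<subseteq> \<Union>(\<Union>n. \<F> n)" .
    moreover have "countable (\<Union>n. \<F> n)" using \<F>(1) by (simp add: countable_finite)
    moreover have "(\<Union>n. \<F> n) \<subseteq> \<U>" using \<F>(2) by blast
    ultimately show ?thesis by (intro exI[of _ "\<Union>n. \<F> n"]) simp
  qed
  then show ?thesis by (subst Lindelof_space_subtopology_subset) auto
qed

text \<open>A compact set \<open>C\<close> lies in the compact set \<open>C - f + F\<close> for any \<open>f \<in> F\<close>. If the sets \<open>N n\<close> form a
  neighbourhood base of \<open>F\<close>, the sets \<open>C - f + N n\<close> form one of \<open>C - f + F\<close>, by Wallace's theorem on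
  neighbourhoods of products of compact sets.\<close>

lemma group_countable_type:
  fixes F :: "'g::{topological_group_add,t2_space} set"
  assumes F: "compact F" "F \<noteq> {}" "countable_character euclidean F"
  shows "countable_type (euclidean :: 'g topology)"
  unfolding countable_type_def
proof (intro allI impI)
  fix C :: "'g set" assume "compactin euclidean C"
  then have C: "compact C" by simp
  obtain f where f: "f \<in> F" using F(2) by blast
  obtain N :: "nat \<Rightarrow> 'g set" where N': "\<And>n. openin euclidean (N n)" "\<And>n. F \<subseteq> N n"
      "\<And>U. openin euclidean U \<Longrightarrow> F \<subseteq> U \<Longrightarrow> \<exists>n. N n \<subseteq> U"
    using countable_characterE[OF F(3)] by metis
  note N = N'[folded open_openin]
  let ?s = "\<lambda>z. fst z + - f + snd z"
  define D where "D = ?s ` (C \<times> F)"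
  have cont: "continuous_on S ?s" for S by (intro continuous_intros)
  have "compact D" unfolding D_def by (intro compact_continuous_image cont compact_Times C F)
  moreover have "C \<subseteq> D"
  proof
    fix c assume "c \<in> C"
    then have "?s (c,f) \<in> D" using f unfolding D_def by blast
    then show "c \<in> D" by (simp add: add.assoc)
  qed
  moreover have "countable_character euclidean D"
    unfolding countable_character_def
  proof (intro exI[of _ "\<lambda>n. \<Union>c\<in>C. {x. (f - c) + x \<in> N n}"] conjI allI impI)
    fix n show "openin euclidean (\<Union>c\<in>C. {x. (f - c) + x \<in> N n})"
      unfolding open_openin[symmetric] using N(1) by (intro open_UN ballI open_group_vimage)
    show "D \<subseteq> (\<Union>c\<in>C. {x. (f - c) + x \<in> N n})"
    proof
      fix x assume "x \<in> D"
      then obtain c y where "c \<in> C" "y \<in> F" "x = c + - f + y" by (auto simp: D_def)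
      moreover from this have "f - c + x = y" by (simp add: diff_conv_add_uminus add.assoc del: add_uminus_conv_diff)
      ultimately have "f - c + x \<in> N n" "c \<in> C" using N(2)[of n] by auto
      then show "x \<in> (\<Union>c\<in>C. {x. (f - c) + x \<in> N n})" by blast
    qed
  next
    fix U assume U: "openin euclidean U \<and> D \<subseteq> U"
    have "open (?s -` U)" by (rule open_vimage[OF _ cont]) (use U in \<open>simp add: open_openin[symmetric]\<close>)
    then have op: "openin (prod_topology euclidean euclidean) (?s -` U)" by simp
    have CF: "C \<times> F \<subseteq> ?s -` U" using U unfolding D_def by blast
    have cp: "compactin euclidean C" "compactin euclidean F" using C F(1) by simp_all
    obtain A B where "openin euclidean A" and B: "openin euclidean B"
      and AB: "C \<subseteq> A" "F \<subseteq> B" "A \<times> B \<subseteq> ?s -` U"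
      by (rule Wallace_theorem_prod_topology[OF cp op CF])
    obtain n where n: "N n \<subseteq> B" using N'(3)[OF B AB(2)] by blast
    have "(\<Union>c\<in>C. {x. (f - c) + x \<in> N n}) \<subseteq> U"
    proof
      fix x assume "x \<in> (\<Union>c\<in>C. {x. (f - c) + x \<in> N n})"
      then obtain c where c: "c \<in> C" "f - c + x \<in> N n" by auto
      then have "?s (c, f - c + x) \<in> U" using AB n by blast
      moreover have "?s (c, f - c + x) = x"
        by (simp add: diff_conv_add_uminus add.assoc del: add_uminus_conv_diff)
      ultimately show "x \<in> U" by simp
    qed
    then show "\<exists>n. (\<Union>c\<in>C. {x. (f - c) + x \<in> N n}) \<subseteq> U" by blast
  qed
  ultimately show "\<exists>D. C \<subseteq> D \<and> compactin euclidean D \<and> countable_character euclidean D" by auto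
qed

section \<open>Metrizability of the compactification\<close>

text \<open>For each pair of members of the network that can be separated by a continuous real function, one such
  function is chosen. By Urysohn's lemma these countably many functions separate points, so they embed
  the compact space in a countable power of the real line.\<close>

lemma compact_countable_network_imp_metrizable:
  assumes K: "compact_space K" "Hausdorff_space K" and N: "countable \<N>"
    and net: "\<And>U x. openin K U \<Longrightarrow> x \<in> U \<Longrightarrow> \<exists>N\<in>\<N>. x \<in> N \<and> N \<subseteq> U"
  shows "metrizable_space K"
proof -
  have reg: "regular_space K" using K by (simp add: compact_Hausdorff_imp_regular_space)
  have nor: "normal_space K" using K compact_Hausdorff_or_regular_imp_normal_space by blast
  define sep where "sep f p \<longleftrightarrow> continuous_map K euclideanreal f \<and> f ` fst p \<subseteq> {0} \<and> f ` snd p \<subseteq> {1}"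
    for f :: "'a \<Rightarrow> real" and p
  define I where "I = {p \<in> \<N> \<times> \<N>. \<exists>f. sep f p}"
  have cI: "countable I" 
    by (rule countable_subset[of _ "\<N> \<times> \<N>"]) (use N in \<open>simp_all add: I_def subset_iff\<close>)
  define f where "f p = (SOME f. sep f p)" for p
  have f: "sep (f p) p" if "p \<in> I" for p
    unfolding f_def by (rule someI_ex[of "\<lambda>f. sep f p"]) (use that in \<open>simp add: I_def\<close>)
  define \<Phi> where "\<Phi> x = (\<lambda>p\<in>I. f p x)" for x
  let ?R = "product_topology (\<lambda>p. euclideanreal) I"
  have cont: "continuous_map K ?R \<Phi>"
    unfolding continuous_map_componentwise
  proof (intro conjI ballI)
    show "\<Phi> ` topspace K \<subseteq> extensional I" by (auto simp: \<Phi>_def)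
    fix p assume p: "p \<in> I"
    then have "continuous_map K euclideanreal (f p)" using f by (simp add: sep_def)
    then show "continuous_map K euclideanreal (\<lambda>x. \<Phi> x p)" using p by (simp add: \<Phi>_def)
  qed
  have "inj_on \<Phi> (topspace K)"
  proof (rule inj_onI, rule ccontr)
    fix x y assume xy: "x \<in> topspace K" "y \<in> topspace K" "\<Phi> x = \<Phi> y" "x \<noteq> y"
    obtain U V where UV: "openin K U" "openin K V" "x \<in> U" "y \<in> V" "disjnt U V"
      using K(2) xy unfolding Hausdorff_space_def by metis
    obtain U' where U': "openin K U'" "x \<in> U'" "K closure_of U' \<subseteq> U"
      using regular_space_closure_nbhd[OF reg UV(1,3)] .
    obtain V' where V': "openin K V'" "y \<in> V'" "K closure_of V' \<subseteq> V"
      using regular_space_closure_nbhd[OF reg UV(2,4)] .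
    have "disjnt (K closure_of U') (K closure_of V')" using U' V' UV(5) unfolding disjnt_def by blast
    then obtain g where g: "continuous_map K (top_of_set {0..1}) g"
      "g ` (K closure_of U') \<subseteq> {0}" "g ` (K closure_of V') \<subseteq> {1::real}"
      by (rule Urysohn_lemma[OF nor closedin_closure_of closedin_closure_of, of U' V' 0 1]) auto
    obtain A where A: "A \<in> \<N>" "x \<in> A" "A \<subseteq> U'" using net[OF U'(1,2)] by blast
    obtain B where B: "B \<in> \<N>" "y \<in> B" "B \<subseteq> V'" using net[OF V'(1,2)] by blast
    have "A \<subseteq> K closure_of U'" "B \<subseteq> K closure_of V'"
      using A(3) B(3) closure_of_subset[OF openin_subset[OF U'(1)]]
        closure_of_subset[OF openin_subset[OF V'(1)]] by blast+
    then have "g ` A \<subseteq> {0}" "g ` B \<subseteq> {1}" using g(2,3) by blast+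
    then have "sep g (A,B)" using g(1) by (simp add: sep_def continuous_map_in_subtopology)
    then have p: "(A,B) \<in> I" using A B by (auto simp: I_def)
    then have "f (A,B) x = 0" "f (A,B) y = 1" using f[OF p] A B by (auto simp: sep_def)
    moreover have "\<Phi> x (A,B) = \<Phi> y (A,B)" using xy by simp
    ultimately show False using p by (simp add: \<Phi>_def)
  qed
  moreover have "Hausdorff_space ?R" by (simp add: Hausdorff_space_product_topology)
  then have "closed_map K ?R \<Phi>" using K(1) cont continuous_imp_closed_map by blast
  ultimately have "embedding_map K ?R \<Phi>"
    using cont injective_closed_imp_embedding_map by blast
  then have "K homeomorphic_space subtopology ?R (\<Phi> ` topspace K)"
    by (rule embedding_map_imp_homeomorphic_space)
  moreover have "metrizable_space ?R"
    using cI countable_subset[of _ I] by (subst metrizable_space_product_topology) (auto simp: metrizable_space_euclidean)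
  then have "metrizable_space (subtopology ?R (\<Phi> ` topspace K))" by (rule metrizable_space_subtopology)
  ultimately show ?thesis using homeomorphic_metrizable_space by blast
qed

text \<open>A nonempty open set of the compactification that misses the remainder would provide one point of the
  group with a compact neighbourhood, and translations carry it to all other points.\<close>

lemma dense_remainder_of_non_locally_compact_group:
  fixes bG :: "'b topology" and e :: "'g::{topological_group_add, t2_space} \<Rightarrow> 'b"
  assumes nlc: "\<not> locally_compact_space (euclidean :: 'g topology)"
    and K: "compact_space bG" "Hausdorff_space bG" and e: "embedding_map euclidean bG e"
    and d: "bG closure_of (range e) = topspace bG"
  shows "bG closure_of (topspace bG - range e) = topspace bG"
proof (rule ccontr)
  assume no: "bG closure_of (topspace bG - range e) \<noteq> topspace bG"
  let ?U = "topspace bG - bG closure_of (topspace bG - range e)"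
  have reg: "regular_space bG" using K by (simp add: compact_Hausdorff_imp_regular_space)
  have cont: "continuous_map euclidean bG e"
    by (rule embedding_map_continuous_map[OF e])
  have U: "openin bG ?U" by (intro openin_diff openin_topspace closedin_closure_of)
  have "?U \<noteq> {}" using no closure_of_subset_topspace[of bG "topspace bG - range e"] by auto
  then obtain p where p: "p \<in> ?U" by blast
  then have "p \<in> bG closure_of (range e)" unfolding d by blast
  then obtain g where g: "e g \<in> ?U" using closure_ofE[OF _ U(1) p] by blast
  obtain V where V: "openin bG V" "e g \<in> V" "bG closure_of V \<subseteq> ?U"
    using regular_space_closure_nbhd[OF reg U(1) g] .
  have "?U \<subseteq> range e" using closure_of_subset[of "topspace bG - range e" bG] by blast
  then have "bG closure_of V \<subseteq> e ` topspace euclidean" using V(3) by simp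
  moreover have "compactin bG (bG closure_of V)" using K(1) by (simp add: closedin_compact_space)
  ultimately have "compactin euclidean {x \<in> topspace euclidean. e x \<in> bG closure_of V}"
    using embedding_map_preimage_compactin[OF e] by blast
  then have C: "compact {x. e x \<in> bG closure_of V}" (is "compact ?C") by simp
  have "openin euclidean {x \<in> topspace euclidean. e x \<in> V}"
    using cont V(1) by (rule openin_continuous_map_preimage)
  then have O': "open {x. e x \<in> V}" by (simp add: open_openin[symmetric])
  have "locally_compact_space (euclidean :: 'g topology)"
    unfolding locally_compact_space_def
  proof (intro ballI exI conjI)
    fix x :: 'g
    let ?O = "{y. (g - x) + y \<in> {x. e x \<in> V}}" and ?K = "(\<lambda>z. (x - g) + z) ` ?C"
    show "openin euclidean ?O" using open_group_vimage(1)[OF O'] by (simp only: open_openin[symmetric])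
    have "compact ?K" by (intro compact_continuous_image C continuous_intros)
    then show "compactin euclidean ?K" by simp
    show "x \<in> ?O" using V(2) by (simp add: diff_conv_add_uminus add.assoc del: add_uminus_conv_diff)
    show "?O \<subseteq> ?K"
    proof
      fix y assume "y \<in> ?O"
      then have "(g - x) + y \<in> ?C"
        using closure_of_subset[OF openin_subset[OF V(1)]] by auto
      moreover have "y = (x - g) + ((g - x) + y)"
        by (simp add: diff_conv_add_uminus add.assoc del: add_uminus_conv_diff)
      ultimately show "y \<in> ?K" by blast
    qed
  qed
  with nlc show False by blast
qed

theorem theorem4p2:
  fixes bG :: "'b topology" and e :: "'g::{topological_group_add, t2_space} \<Rightarrow> 'b"
  assumes "\<not> locally_compact_space (euclidean :: 'g topology)"
    and "hausdorff_compactification (euclidean :: 'g topology) bG e"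
    and "has_BCO (subtopology bG (topspace bG - range e))"
    and "ohio_complete (subtopology bG (topspace bG - range e))"
  shows "separable_space (euclidean :: 'g topology) \<and> metrizable_space (euclidean :: 'g topology)
       \<and> separable_space bG \<and> metrizable_space bG"
proof -
  define Y where "Y = topspace bG - range e"
  let ?G = "euclidean :: 'g topology"
  have K: "compact_space bG" "Hausdorff_space bG" and e: "embedding_map ?G bG e"
    and d: "bG closure_of (e ` topspace ?G) = topspace bG"
    using assms(2) by (simp_all add: hausdorff_compactification_def)
  have BCO: "has_BCO (subtopology bG Y)" and Ohio: "ohio_complete (subtopology bG Y)"
    using assms(3,4) by (simp_all add: Y_def)
  have reg: "regular_space bG" using K by (simp add: compact_Hausdorff_imp_regular_space)
  have cont: "continuous_map ?G bG e"
    by (rule embedding_map_continuous_map[OF e])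
  have eK: "range e \<subseteq> topspace bG" using continuous_map_image_subset_topspace[OF cont] by simp
  have dY: "bG closure_of Y = topspace bG"
    unfolding Y_def
    by (rule dense_remainder_of_non_locally_compact_group[OF assms(1) K e]) (use d in simp)
  have topY: "topspace (subtopology bG Y) = Y" by (auto simp: Y_def)
  have "hausdorff_compactification (subtopology bG Y) bG (\<lambda>x. x)"
    unfolding hausdorff_compactification_def
    using K dY topY by (simp add: embedding_map_def homeomorphic_map_id[unfolded id_def])
  then have "ohio_complete_in bG ((\<lambda>x. x) ` topspace (subtopology bG Y))"
    by (rule ohio_complete_imp_ohio_complete_in[OF Ohio])
  then have "ohio_complete_in bG Y" by (simp only: topY image_ident)
  then obtain Z where Z: "gdelta_in bG Z" "Y \<subseteq> Z"
    "\<forall>y\<in>Z - Y. \<exists>P. gdelta_in (subtopology bG Z) P \<and> y \<in> P \<and> P \<inter> Y = {}"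
    unfolding ohio_complete_in_def by (elim exE conjE)
  have "\<exists>F::'g set. compact F \<and> F \<noteq> {} \<and> countable_character ?G F"
  proof (cases "Z = Y")
    case True
    then have gY: "gdelta_in bG Y" using Z(1) by simp
    then have "fsigma_in bG (topspace bG - Y)" by (simp add: gdelta_in_fsigma_in)
    moreover have "topspace bG - Y = range e" using eK by (auto simp: Y_def)
    ultimately obtain C :: "nat \<Rightarrow> 'b set" where C: "\<And>n. closedin bG (C n)" "\<Union>(range C) = range e"
      unfolding fsigma_in_ascending by auto
    have "ccc_space ?G"
    proof (rule sigma_compact_group_ccc)
      fix n
      have "compactin bG (C n)" using K(1) C(1) closedin_compact_space by blast
      moreover have "C n \<subseteq> e ` topspace ?G" using C(2) by auto
      ultimately have "compactin ?G {x \<in> topspace ?G. e x \<in> C n}"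
        by (rule embedding_map_preimage_compactin[OF e])
      then show "compact {x. e x \<in> C n}" by simp
    next
      show "(\<Union>n. {x. e x \<in> C n}) = UNIV" using C(2) by blast
    qed
    then have "ccc_space bG" using cont d by (rule ccc_space_dense_image)
    then have "ccc_space (subtopology bG Y)"
      by (rule ccc_space_dense_subspace[OF _ dY]) (auto simp: Y_def)
    then obtain \<P> where P: "countable \<P>" "pi_base (subtopology bG Y) \<P>"
      using countable_pi_base_BCO[OF K gY dY _ BCO] by metis
    obtain \<Q> where "countable \<Q>" "pi_base bG \<Q>" using pi_base_dense_subspace_extend[OF reg dY P] .
    then obtain \<R> where R: "countable \<R>" "pi_base ?G \<R>"
      using pi_base_dense_embedding_pullback[OF e d] by metis
    obtain N :: "nat \<Rightarrow> 'g set" where N: "\<And>n. open (N n)" "\<And>n. 0 \<in> N n"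
      "\<And>U. open U \<Longrightarrow> 0 \<in> U \<Longrightarrow> \<exists>n. N n \<subseteq> U"
      using group_pi_base_imp_countable_nbhd_base[OF R] by metis
    have "countable_character ?G {0}"
      unfolding countable_character_def using N by (intro exI[of _ N]) (simp add: open_openin[symmetric])
    then show ?thesis by (intro exI[of _ "{0}"]) simp
  next
    case False
    then obtain z where z: "z \<in> Z" "z \<notin> Y" using Z(2) by blast
    then obtain P where P: "gdelta_in (subtopology bG Z) P" "z \<in> P" "P \<inter> Y = {}" using Z(3) by blast
    have "gdelta_in bG P" using P(1) Z(1) by (simp add: gdelta_in_gdelta_subtopology)
    then obtain F where F: "closedin bG F" "z \<in> F" "F \<subseteq> P" "countable_character bG F"
      using gdelta_point_countable_character[OF K _ P(2)] by metis
    have sub: "F \<subseteq> e ` topspace ?G" using F(3) P(3) closedin_subset[OF F(1)] by (auto simp: Y_def)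
    let ?F = "{x \<in> topspace ?G. e x \<in> F}"
    have "compactin bG F" using K(1) F(1) closedin_compact_space by blast
    then have "compactin ?G ?F" using sub by (rule embedding_map_preimage_compactin[OF e])
    moreover have "countable_character ?G ?F" by (rule embedding_map_countable_character[OF e sub F(4)])
    moreover have "?F \<noteq> {}" using F(2) sub by auto
    ultimately show ?thesis by (intro exI[of _ ?F]) simp
  qed
  then have "countable_type ?G" using group_countable_type by blast
  then have "Lindelof_space (subtopology bG (topspace bG - e ` topspace ?G))"
    by (rule countable_type_imp_Lindelof_remainder[OF K e d])
  then have "Lindelof_space (subtopology bG Y)" by (simp add: Y_def)
  then have scY: "second_countable (subtopology bG Y)"
    using Lindelof_space_BCO_imp_second_countable[OF _ regular_space_subtopology[OF reg] BCO] by blast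
  obtain \<P> where P: "countable \<P>" "pi_base (subtopology bG Y) \<P>"
    using second_countable_imp_countable_pi_base[OF scY] .
  obtain \<Q> where Q: "countable \<Q>" "pi_base bG \<Q>" using pi_base_dense_subspace_extend[OF reg dY P] .
  obtain \<R> where R: "countable \<R>" "pi_base ?G \<R>"
    using pi_base_dense_embedding_pullback[OF e d Q] .
  have scG: "second_countable ?G" by (rule group_pi_base_imp_second_countable[OF R])
  obtain \<A> where A: "countable \<A>" "\<forall>U x. openin ?G U \<and> x \<in> U \<longrightarrow> (\<exists>V\<in>\<A>. x \<in> V \<and> V \<subseteq> U)"
    using scG unfolding second_countable_def by (elim exE conjE)
  obtain \<B> where B: "countable \<B>"
    "\<forall>U x. openin (subtopology bG Y) U \<and> x \<in> U \<longrightarrow> (\<exists>V\<in>\<B>. x \<in> V \<and> V \<subseteq> U)"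
    using scY unfolding second_countable_def by (elim exE conjE)
  have mK: "metrizable_space bG"
  proof (rule compact_countable_network_imp_metrizable[OF K, of "(`) e ` \<A> \<union> \<B>"])
    show "countable ((`) e ` \<A> \<union> \<B>)" using A(1) B(1) by simp
    fix U x assume U: "openin bG U" "x \<in> U"
    show "\<exists>N\<in>(`) e ` \<A> \<union> \<B>. x \<in> N \<and> N \<subseteq> U"
    proof (cases "x \<in> Y")
      case True
      have "openin (subtopology bG Y) (U \<inter> Y)" using U(1) by (auto simp: openin_subtopology)
      then obtain V where "V \<in> \<B>" "x \<in> V" "V \<subseteq> U \<inter> Y" using B(2)[rule_format, of "U \<inter> Y" x] U True by auto
      then show ?thesis by blast
    next
      case False
      then obtain g where g: "x = e g" using U openin_subset by (auto simp: Y_def)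
      have "openin ?G {y \<in> topspace ?G. e y \<in> U}" by (rule openin_continuous_map_preimage[OF cont U(1)])
      then obtain V where "V \<in> \<A>" "g \<in> V" "V \<subseteq> {y. e y \<in> U}"
        using A(2)[rule_format, of "{y. e y \<in> U}" g] U(2) g by auto
      then show ?thesis using g by blast
    qed
  qed
  have mG: "metrizable_space ?G"
    using embedding_map_imp_homeomorphic_space[OF e] metrizable_space_subtopology[OF mK]
      homeomorphic_metrizable_space by blast
  have sG: "separable_space ?G" by (rule second_countable_imp_separable_space[OF scG])
  then obtain D :: "'g set" where D: "countable D" "?G closure_of D = topspace ?G"
    unfolding separable_space_def by auto
  have "e ` topspace ?G \<subseteq> bG closure_of (e ` D)"
    using continuous_map_image_closure_subset[OF cont, of D] D(2) by simp
  then have "bG closure_of (e ` topspace ?G) \<subseteq> bG closure_of (e ` D)" by (simp add: closure_of_minimal)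
  then have "bG closure_of (e ` D) = topspace bG" using d closure_of_subset_topspace[of bG "e ` D"] by simp
  moreover have "countable (e ` D)" "e ` D \<subseteq> topspace bG" using D(1) eK by auto
  ultimately have "separable_space bG" unfolding separable_space_def by blast
  with sG mG mK show ?thesis by blast
qed

end
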